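(* Let $u$ be the optimal control of the optimal control problem described in the context, with optimal state $y(u)$ and adjoint state $p(u)$. Then the majorant $\mathcal{M}_1^\oplus$ satisfies $$\inf_{\eta,\zeta\in V,\ \boldsymbol{\tau},\boldsymbol{\rho}\in H(\mathrm{div},\Omega),\ \alpha,\beta>0}\mathcal{M}_1^\oplus(\alpha,\beta;\eta,\zeta,\boldsymbol{\tau},\boldsymbol{\rho},v_\zeta)=0,$$ where $v_\zeta(\boldsymbol{x})=\min\{u_b(\boldsymbol{x}),\max\{u_a(\boldsymbol{x}),u_d(\boldsymbol{x})-\tfrac1\lambda\zeta(\boldsymbol{x})\}\}$ for a.e. $\boldsymbol{x}\in\Omega$. The infimum is attained on the exact solution $v_\zeta=u$, $\eta=y(u)$, $\zeta=p(u)$, $\boldsymbol{\tau}=\nu\nabla y(u)$, $\boldsymbol{\rho}=\nu\nabla p(u)$, in the sense that for these arguments $\inf_{\alpha,\beta>0}\mathcal{M}_1^\oplus(\alpha,\beta;y(u),p(u),\nu\nabla y(u),\nu\nabla p(u),u)=0$.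
   Context: Let $\Omega\subset\mathbb{R}^d$, $d\in\{1,2,3\}$, be a bounded Lipschitz domain, $V=H^1_0(\Omega)$, $y_d,u_d,f\in L^2(\Omega)$, $\lambda>0$. Let $\nu:\Omega\to\mathbb{R}$ be measurable with $0<\underline{\nu}\le\nu(\boldsymbol{x})\le\overline{\nu}$ for constants $\underline\nu,\overline\nu$. All functions are real valued; $\|\cdot\|$ is the $L^2(\Omega)$-norm (also for vector fields). $H(\mathrm{div},\Omega)=\{\boldsymbol{\tau}\in[L^2(\Omega)]^d:\mathrm{div}\,\boldsymbol{\tau}\in L^2(\Omega)\}$. $C_F>0$ is a Friedrichs constant: $\|w\|\le C_F\|\nabla w\|$ for all $w\in V$. For $v\in L^2(\Omega)$, $y(v)\in V$ is the weak solution of $\int_\Omega\nu\nabla y(v)\cdot\nabla w\,d\boldsymbol{x}=\int_\Omega(f+v)w\,d\boldsymbol{x}$ for all $w\in V$. The cost functional is $\mathcal{J}(y(v),v)=\frac12\|y(v)-y_d\|^2+\frac\lambda2\|v-u_d\|^2$. Admissible controls: $U_{\mathrm{ad}}=\{v\in L^2(\Omega):u_a\le v\le u_b\text{ a.e. in }\Omega\}$, where $u_a,u_b\in L^2(\Omega)$, $u_a\le u_b$ a.e. The optimal control $u$ is the unique minimizer of $v\mapsto\mathcal{J}(y(v),v)$ over $U_{\mathrm{ad}}$; equivalently, with $y=y(u)$ and the adjoint state $p=p(u)\in V$, the triple $(y,u,p)$ solves the optimality system consisting of the state equation for $y$ with control $u$, $\int_\Omega\nu\nabla p\cdot\nabla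 w\,d\boldsymbol{x}=\int_\Omega(y-y_d)w\,d\boldsymbol{x}$ for all $w\in V$, and $\int_\Omega(p+\lambda(u-u_d))(w-u)\,d\boldsymbol{x}\ge0$ for all $w\in U_{\mathrm{ad}}$. The majorant is $$\mathcal{M}_1^\oplus(\alpha,\beta;\eta,\zeta,\boldsymbol{\tau},\boldsymbol{\rho},v_\zeta)=\tfrac\alpha2\|\eta-y_d\|^2+\tfrac{(1+\alpha)(1+\beta)C_F^2}{2\alpha\underline\nu^2}\|\boldsymbol{\tau}-\nu\nabla\eta\|^2+\tfrac{(1+\alpha)(1+\beta)C_F^4}{2\alpha\beta\underline\nu^2}\|f+v_\zeta+\mathrm{div}\,\boldsymbol{\tau}\|^2$$ $$-\int_\Omega(f+v_\zeta+\mathrm{div}\,\boldsymbol{\tau})\zeta\,d\boldsymbol{x}-\int_\Omega(\boldsymbol{\tau}-\nu\nabla\eta)\cdot\nabla\zeta\,d\boldsymbol{x}$$ $$+\tfrac1{\underline\nu}\big(C_F\|\eta-y_d+\mathrm{div}\,\boldsymbol{\rho}\|+\|\boldsymbol{\rho}-\nu\nabla\zeta\|\big)\Big(\tfrac{C_F^3}{\lambda\underline\nu}\|\eta-y_d+\mathrm{div}\,\boldsymbol{\rho}\|+\tfrac{C_F^2}{\lambda\underline\nu}\|\boldsymbol{\rho}-\nu\nabla\zeta\|+C_F\|f+v_\zeta+\mathrm{div}\,\boldsymbol{\tau}\|+\|\boldsymbol{\tau}-\nu\nabla\eta\|\Big)$$ $$+\tfrac{3\lambda}{2C_F^2}\big(\|\boldsymbol{\tau}-\nu\nabla\eta\|+C_F\|f+v_\zeta+\mathrm{div}\,\boldsymbol{\tau}\|\big)^2.$$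 *)

theory Defs
  imports "HOL-Analysis.Analysis"
begin

text \<open>
  Functions on \<open>\<Omega>\<close> are represented by total functions; their values outside \<open>\<Omega>\<close> play no role.
  Elements of \<open>L\<^sup>2(\<Omega>)\<close> are functions rather than a.e.-equivalence classes.
\<close>

text \<open>
  Near each boundary point the domain is, in suitable orthonormal coordinates with axis \<open>e\<close>, the
  strict epigraph of a Lipschitz function on the hyperplane orthogonal to \<open>e\<close>.
\<close>

definition bounded_Lipschitz_domain :: "'a::euclidean_space set \<Rightarrow> bool" where
  "bounded_Lipschitz_domain \<Omega> \<longleftrightarrow>
     open \<Omega> \<and> connected \<Omega> \<and> \<Omega> \<noteq> {} \<and> bounded \<Omega> \<and>
     (\<forall>z\<in>frontier \<Omega>. \<exists>r>0. \<exists>e \<gamma> L. norm e = 1 \<and> L-lipschitz_on {x. x \<bullet> e = 0} (\<gamma> :: 'a \<Rightarrow> real) \<and>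
        \<Omega> \<inter> ball z r = {x \<in> ball z r. \<gamma> (x - (x \<bullet> e) *\<^sub>R e) < x \<bullet> e})"

definition L2 :: "'a::euclidean_space set \<Rightarrow> ('a \<Rightarrow> 'b::euclidean_space) set" where
  "L2 \<Omega> = {f \<in> borel_measurable (lebesgue_on \<Omega>). integrable (lebesgue_on \<Omega>) (\<lambda>x. (norm (f x))\<^sup>2)}"

definition L2_norm :: "'a::euclidean_space set \<Rightarrow> ('a \<Rightarrow> 'b::euclidean_space) \<Rightarrow> real" where
  "L2_norm \<Omega> f = sqrt (LINT x|lebesgue_on \<Omega>. (norm (f x))\<^sup>2)"

primrec C_k :: "nat \<Rightarrow> ('a::euclidean_space \<Rightarrow> real) \<Rightarrow> bool" where
  "C_k 0 \<phi> \<longleftrightarrow> continuous_on UNIV \<phi>"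
| "C_k (Suc k) \<phi> \<longleftrightarrow> (\<forall>x. \<phi> differentiable at x) \<and>
     (\<forall>b\<in>Basis. C_k k (\<lambda>x. frechet_derivative \<phi> (at x) b))"

definition test_functions :: "'a::euclidean_space set \<Rightarrow> ('a \<Rightarrow> real) set" where
  "test_functions \<Omega> = {\<phi>. (\<forall>k. C_k k \<phi>) \<and> compact (closure {x. \<phi> x \<noteq> 0}) \<and> closure {x. \<phi> x \<noteq> 0} \<subseteq> \<Omega>}"

definition classical_grad :: "('a::euclidean_space \<Rightarrow> real) \<Rightarrow> 'a \<Rightarrow> 'a" where
  "classical_grad \<phi> x = (\<Sum>b\<in>Basis. frechet_derivative \<phi> (at x) b *\<^sub>R b)"

definition has_weak_grad :: "'a::euclidean_space set \<Rightarrow> ('a \<Rightarrow> real) \<Rightarrow> ('a \<Rightarrow> 'a) \<Rightarrow> bool" where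
  "has_weak_grad \<Omega> w g \<longleftrightarrow> g \<in> L2 \<Omega> \<and>
     (\<forall>\<phi>\<in>test_functions \<Omega>.
        (LINT x|lebesgue_on \<Omega>. w x *\<^sub>R classical_grad \<phi> x) = - (LINT x|lebesgue_on \<Omega>. \<phi> x *\<^sub>R g x))"

definition has_weak_div :: "'a::euclidean_space set \<Rightarrow> ('a \<Rightarrow> 'a) \<Rightarrow> ('a \<Rightarrow> real) \<Rightarrow> bool" where
  "has_weak_div \<Omega> \<tau> g \<longleftrightarrow> g \<in> L2 \<Omega> \<and>
     (\<forall>\<phi>\<in>test_functions \<Omega>.
        (LINT x|lebesgue_on \<Omega>. \<tau> x \<bullet> classical_grad \<phi> x) = - (LINT x|lebesgue_on \<Omega>. \<phi> x * g x))"

text \<open>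
  Weak gradients, weak divergences and (below) weak solutions are unique up to null sets;
  the choice operator picks a representative.
\<close>

definition weak_grad :: "'a::euclidean_space set \<Rightarrow> ('a \<Rightarrow> real) \<Rightarrow> 'a \<Rightarrow> 'a" where
  "weak_grad \<Omega> w = (SOME g. has_weak_grad \<Omega> w g)"

definition weak_div :: "'a::euclidean_space set \<Rightarrow> ('a \<Rightarrow> 'a) \<Rightarrow> 'a \<Rightarrow> real" where
  "weak_div \<Omega> \<tau> = (SOME g. has_weak_div \<Omega> \<tau> g)"

definition H1 :: "'a::euclidean_space set \<Rightarrow> ('a \<Rightarrow> real) set" where
  "H1 \<Omega> = {w \<in> L2 \<Omega>. \<exists>g. has_weak_grad \<Omega> w g}"

text \<open>The closure of the test functions in the \<open>H\<^sup>1\<close>-norm.\<close>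

definition H10 :: "'a::euclidean_space set \<Rightarrow> ('a \<Rightarrow> real) set" where
  "H10 \<Omega> = {w \<in> H1 \<Omega>. \<exists>\<phi> :: nat \<Rightarrow> 'a \<Rightarrow> real. (\<forall>n. \<phi> n \<in> test_functions \<Omega>) \<and>
      (\<lambda>n. L2_norm \<Omega> (\<lambda>x. \<phi> n x - w x)) \<longlonglongrightarrow> 0 \<and>
      (\<lambda>n. L2_norm \<Omega> (\<lambda>x. classical_grad (\<phi> n) x - weak_grad \<Omega> w x)) \<longlonglongrightarrow> 0}"

definition Hdiv :: "'a::euclidean_space set \<Rightarrow> ('a \<Rightarrow> 'a) set" where
  "Hdiv \<Omega> = {\<tau> \<in> L2 \<Omega>. \<exists>g. has_weak_div \<Omega> \<tau> g}"

definition is_weak_solution ::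
    "'a::euclidean_space set \<Rightarrow> ('a \<Rightarrow> real) \<Rightarrow> ('a \<Rightarrow> real) \<Rightarrow> ('a \<Rightarrow> real) \<Rightarrow> bool" where
  "is_weak_solution \<Omega> \<nu> g z \<longleftrightarrow> z \<in> H10 \<Omega> \<and>
     (\<forall>w\<in>H10 \<Omega>. (LINT x|lebesgue_on \<Omega>. \<nu> x * (weak_grad \<Omega> z x \<bullet> weak_grad \<Omega> w x)) =
                (LINT x|lebesgue_on \<Omega>. g x * w x))"

definition weak_solution ::
    "'a::euclidean_space set \<Rightarrow> ('a \<Rightarrow> real) \<Rightarrow> ('a \<Rightarrow> real) \<Rightarrow> 'a \<Rightarrow> real" where
  "weak_solution \<Omega> \<nu> g = (SOME z. is_weak_solution \<Omega> \<nu> g z)"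

definition state ::
    "'a::euclidean_space set \<Rightarrow> ('a \<Rightarrow> real) \<Rightarrow> ('a \<Rightarrow> real) \<Rightarrow> ('a \<Rightarrow> real) \<Rightarrow> 'a \<Rightarrow> real" where
  "state \<Omega> \<nu> f v = weak_solution \<Omega> \<nu> (\<lambda>x. f x + v x)"

definition adjoint_state ::
    "'a::euclidean_space set \<Rightarrow> ('a \<Rightarrow> real) \<Rightarrow> ('a \<Rightarrow> real) \<Rightarrow> ('a \<Rightarrow> real) \<Rightarrow> ('a \<Rightarrow> real) \<Rightarrow> 'a \<Rightarrow> real" where
  "adjoint_state \<Omega> \<nu> f y\<^sub>d v = weak_solution \<Omega> \<nu> (\<lambda>x. state \<Omega> \<nu> f v x - y\<^sub>d x)"

definition cost ::
    "'a::euclidean_space set \<Rightarrow> real \<Rightarrow> ('a \<Rightarrow> real) \<Rightarrow> ('a \<Rightarrow> real) \<Rightarrow> ('a \<Rightarrow> real) \<Rightarrow> ('a \<Rightarrow> real) \<Rightarrow> real" where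
  "cost \<Omega> lam y\<^sub>d u\<^sub>d y v =
     1/2 * (L2_norm \<Omega> (\<lambda>x. y x - y\<^sub>d x))\<^sup>2 + lam/2 * (L2_norm \<Omega> (\<lambda>x. v x - u\<^sub>d x))\<^sup>2"

definition U_ad :: "'a::euclidean_space set \<Rightarrow> ('a \<Rightarrow> real) \<Rightarrow> ('a \<Rightarrow> real) \<Rightarrow> ('a \<Rightarrow> real) set" where
  "U_ad \<Omega> u\<^sub>a u\<^sub>b = {v \<in> L2 \<Omega>. AE x in lebesgue_on \<Omega>. u\<^sub>a x \<le> v x \<and> v x \<le> u\<^sub>b x}"

definition optimal_control ::
    "'a::euclidean_space set \<Rightarrow> ('a \<Rightarrow> real) \<Rightarrow> real \<Rightarrow> ('a \<Rightarrow> real) \<Rightarrow> ('a \<Rightarrow> real) \<Rightarrow> ('a \<Rightarrow> real) \<Rightarrow>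
     ('a \<Rightarrow> real) \<Rightarrow> ('a \<Rightarrow> real) \<Rightarrow> ('a \<Rightarrow> real) \<Rightarrow> bool" where
  "optimal_control \<Omega> \<nu> lam f y\<^sub>d u\<^sub>d u\<^sub>a u\<^sub>b u \<longleftrightarrow>
     is_arg_min (\<lambda>v. cost \<Omega> lam y\<^sub>d u\<^sub>d (state \<Omega> \<nu> f v) v) (\<lambda>v. v \<in> U_ad \<Omega> u\<^sub>a u\<^sub>b) u"

definition v_proj ::
    "real \<Rightarrow> ('a \<Rightarrow> real) \<Rightarrow> ('a \<Rightarrow> real) \<Rightarrow> ('a \<Rightarrow> real) \<Rightarrow> ('a \<Rightarrow> real) \<Rightarrow> 'a \<Rightarrow> real" where
  "v_proj lam u\<^sub>d u\<^sub>a u\<^sub>b \<zeta> x = min (u\<^sub>b x) (max (u\<^sub>a x) (u\<^sub>d x - 1/lam * \<zeta> x))"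

text \<open>
  The parameter \<open>nu_lo\<close> is the lower bound of \<open>\<nu>\<close>. In the body, \<open>A\<close> and \<open>B\<close> are the norms of the
  residuals of the state equation, \<open>D\<close> and \<open>E\<close> those of the adjoint equation.
\<close>

definition majorant ::
    "'a::euclidean_space set \<Rightarrow> ('a \<Rightarrow> real) \<Rightarrow> real \<Rightarrow> real \<Rightarrow> real \<Rightarrow> ('a \<Rightarrow> real) \<Rightarrow> ('a \<Rightarrow> real) \<Rightarrow>
     real \<Rightarrow> real \<Rightarrow> ('a \<Rightarrow> real) \<Rightarrow> ('a \<Rightarrow> real) \<Rightarrow> ('a \<Rightarrow> 'a) \<Rightarrow> ('a \<Rightarrow> 'a) \<Rightarrow> ('a \<Rightarrow> real) \<Rightarrow> real" where
  "majorant \<Omega> \<nu> nu_lo C\<^sub>F lam f y\<^sub>d \<alpha> \<beta> \<eta> \<zeta> \<tau> \<rho> v =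
    (let A = L2_norm \<Omega> (\<lambda>x. \<tau> x - \<nu> x *\<^sub>R weak_grad \<Omega> \<eta> x);
         B = L2_norm \<Omega> (\<lambda>x. f x + v x + weak_div \<Omega> \<tau> x);
         D = L2_norm \<Omega> (\<lambda>x. \<eta> x - y\<^sub>d x + weak_div \<Omega> \<rho> x);
         E = L2_norm \<Omega> (\<lambda>x. \<rho> x - \<nu> x *\<^sub>R weak_grad \<Omega> \<zeta> x)
     in \<alpha>/2 * (L2_norm \<Omega> (\<lambda>x. \<eta> x - y\<^sub>d x))\<^sup>2
        + (1 + \<alpha>) * (1 + \<beta>) * C\<^sub>F^2 / (2 * \<alpha> * nu_lo^2) * A\<^sup>2
        + (1 + \<alpha>) * (1 + \<beta>) * C\<^sub>F^4 / (2 * \<alpha> * \<beta> * nu_lo^2) * B\<^sup>2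
        - (LINT x|lebesgue_on \<Omega>. (f x + v x + weak_div \<Omega> \<tau> x) * \<zeta> x)
        - (LINT x|lebesgue_on \<Omega>. (\<tau> x - \<nu> x *\<^sub>R weak_grad \<Omega> \<eta> x) \<bullet> weak_grad \<Omega> \<zeta> x)
        + 1/nu_lo * (C\<^sub>F * D + E) *
            (C\<^sub>F^3 / (lam * nu_lo) * D + C\<^sub>F^2 / (lam * nu_lo) * E + C\<^sub>F * B + A)
        + 3 * lam / (2 * C\<^sub>F^2) * (A + C\<^sub>F * B)\<^sup>2)"

end

theory Submission
  imports Defs "HOL-Computational_Algebra.Polynomial"
begin

text \<open>
  Nonnegativity of the majorant is elementary and uses neither optimality nor the special form of
  \<open>v\<close>: testing the adjoint residuals with \<open>\<zeta>\<close> bounds \<open>nu_lo * \<parallel>\<nabla>\<zeta>\<parallel>\<close> by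
  \<open>E + C\<^sub>F * D + C\<^sub>F * \<parallel>\<eta> - y\<^sub>d\<parallel>\<close>; the two sign-indefinite integrals are at least
  \<open>- (A + C\<^sub>F * B) * \<parallel>\<nabla>\<zeta>\<parallel>\<close>, and Young's inequality absorbs this into the remaining terms.
  At the exact solution all residuals vanish and the majorant is \<open>\<alpha> / 2 * \<parallel>y - y\<^sub>d\<parallel>\<^sup>2\<close>, which
  tends to \<open>0\<close> with \<open>\<alpha>\<close>. That the projection of the adjoint state is \<open>u\<close> is the variational
  inequality tested with the projection itself.

  Weak solutions exist because a minimising sequence of test functions for the Dirichlet functional
  is Cauchy; weak gradients and divergences are unique by the fundamental lemma of the calculus of
  variations, where indicators of boxes are approximated by smooth bumps.
\<close>

section \<open>Smooth bump functions\<close>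

text \<open>\<open>weak_grad\<close>, \<open>weak_div\<close> and \<open>weak_solution\<close>
  choose among functions that agree almost everywhere, so identities about them hold in general only
  almost everywhere. \<open>H10_pair\<close> therefore carries a function with any admissible
  gradient, and only finished results pass to the chosen one. Since \<open>H10\<close> is a closure
  of test functions, an identity that is continuous in function and gradient need only be checked on
  test functions.

  A discriminant argument takes the place of a projection theorem in Hilbert space. If a test
  function lies within s of the infimum of the Dirichlet functional, then s + t * R + t^2 * e / 2 is
  nonnegative for all t, where R is its Euler-Lagrange residual in a direction of energy e. Hence
  R^2 \<le> 2 * s * e. This estimate shows both that the sequence is Cauchy and that its limit
  solves the equation; Friedrichs' inequality carries convergence from gradients to functions.

  The parameter \<alpha> must tend to 0 at the exact arguments: there the majorant is positive for
  each admissible \<alpha> unless the state equals \<open>y\<^sub>d\<close> almost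
  everywhere.\<close>

lemma C_k_SucI:
  assumes "\<And>x. (\<phi> has_derivative D x) (at x)" "\<And>b. b \<in> Basis \<Longrightarrow> C_k k (\<lambda>x. D x b)"
  shows "C_k (Suc k) \<phi>"
proof -
  have "frechet_derivative \<phi> (at x) = D x" for x
    using assms(1)[of x] by (simp add: frechet_derivative_at[symmetric])
  then show ?thesis
    using assms by (auto simp: differentiable_def)
qed

lemma C_k_SucD:
  assumes "C_k (Suc k) \<phi>"
  shows "(\<phi> has_derivative frechet_derivative \<phi> (at x)) (at x)"
    and "b \<in> Basis \<Longrightarrow> C_k k (\<lambda>x. frechet_derivative \<phi> (at x) b)"
  using assms by (auto simp: frechet_derivative_works)

lemma C_k_continuous: "C_k k \<phi> \<Longrightarrow> continuous_on UNIV \<phi>"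
  by (cases k) (auto intro!: differentiable_imp_continuous_on simp: differentiable_on_def
      differentiable_at_withinI)

lemma C_k_Suc_imp: "C_k (Suc k) \<phi> \<Longrightarrow> C_k k \<phi>"
proof (induction k arbitrary: \<phi>)
  case 0
  then show ?case using C_k_continuous by (metis C_k.simps(1))
next
  case (Suc k)
  then show ?case by (auto simp del: C_k.simps(2) simp: C_k.simps(2)[of "Suc k"] C_k.simps(2)[of k \<phi>])
qed

lemma C_k_const: "C_k k (\<lambda>x. c)"
  by (induction k arbitrary: c) (auto intro!: C_k_SucI[where D="\<lambda>x h. 0"] simp del: C_k.simps(2))

lemma C_k_inner: "C_k k (\<lambda>x. x \<bullet> c)"
  by (cases k) (auto intro!: C_k_SucI[where D="\<lambda>x h. h \<bullet> c"] derivative_eq_intros continuous_intros C_k_const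
      simp del: C_k.simps(2))

lemma C_k_add: "C_k k f \<Longrightarrow> C_k k g \<Longrightarrow> C_k k (\<lambda>x. f x + g x)"
proof (induction k arbitrary: f g)
  case (Suc k)
  show ?case
    by (rule C_k_SucI) (rule has_derivative_add C_k_SucD Suc | assumption)+
qed (auto intro: continuous_intros)

text \<open>Each summand of the product rule keeps one factor undifferentiated;
  \<open>C_k_Suc_imp\<close> lowers the order of that factor so that the induction hypothesis
  applies.\<close>

lemma C_k_mult: "C_k k f \<Longrightarrow> C_k k g \<Longrightarrow> C_k k (\<lambda>x. f x * g x)"
proof (induction k arbitrary: f g)
  case (Suc k)
  show ?case
    by (rule C_k_SucI, rule has_derivative_mult)
      (rule C_k_SucD C_k_add Suc.IH Suc.prems C_k_Suc_imp | assumption)+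
qed (auto intro: continuous_intros)

text \<open>The family \<open>H\<close> packages a smooth function with all its derivatives. The
  chain rule replaces \<open>H n\<close> by \<open>H (Suc n)\<close>, so the induction must leave
  \<open>n\<close> arbitrary.\<close>

lemma C_k_compose:
  assumes "\<And>n t. (H n has_real_derivative H (Suc n) t) (at t)" "C_k k \<phi>"
  shows "C_k k (\<lambda>x. H n (\<phi> x))"
  using assms(2)
proof (induction k arbitrary: n)
  case 0
  have "continuous_on UNIV (H n)"
    using assms(1) by (meson DERIV_isCont continuous_at_imp_continuous_on)
  with 0 show ?case
    by (auto intro: continuous_on_compose2)
next
  case (Suc k)
  have "((\<lambda>x. H n (\<phi> x)) has_derivative (\<lambda>h. H (Suc n) (\<phi> x) * frechet_derivative \<phi> (at x) h)) (at x)" for x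
    using has_derivative_compose[OF C_k_SucD(1)[OF Suc.prems, of x] assms(1)[of n, unfolded has_field_derivative_def]]
    by simp
  then show ?case
    by (rule C_k_SucI) (rule C_k_mult Suc.IH C_k_SucD Suc.prems C_k_Suc_imp | assumption)+
qed

lemma C_k_prod: "finite I \<Longrightarrow> (\<And>i. i \<in> I \<Longrightarrow> C_k k (f i)) \<Longrightarrow> C_k k (\<lambda>x. \<Prod>i\<in>I. f i x)"
  by (induction I rule: finite_induct) (auto intro: C_k_mult C_k_const)

lemma C_k_affine: "C_k k (\<lambda>x. s * (x \<bullet> c) + t)"
  by (intro C_k_add C_k_mult C_k_const C_k_inner)

text \<open>The \<open>n\<close>-th derivative of \<open>exp (- 1 / t)\<close> is \<open>P (1 / t) * exp (- 1 / t)\<close> for a polynomial \<open>P\<close>.\<close>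

primrec bump_poly :: "nat \<Rightarrow> real poly" where
  "bump_poly 0 = 1"
| "bump_poly (Suc n) = monom 1 2 * (bump_poly n - pderiv (bump_poly n))"

definition bump_deriv :: "nat \<Rightarrow> real \<Rightarrow> real" where
  "bump_deriv n t = (if t > 0 then poly (bump_poly n) (1/t) * exp (- (1/t)) else 0)"

definition bump :: "real \<Rightarrow> real" where
  "bump = bump_deriv 0"

lemma tendsto_poly_exp_at_top: "((\<lambda>s. poly p s * exp (- s)) \<longlongrightarrow> (0::real)) at_top"
proof -
  have "((\<lambda>s. \<Sum>i\<le>degree p. coeff p i * (s ^ i / exp s)) \<longlongrightarrow> (\<Sum>i\<le>degree p. coeff p i * 0)) at_top"
    by (intro tendsto_intros tendsto_power_div_exp_0)
  then show ?thesis
    by (simp add: poly_altdef sum_distrib_right exp_minus divide_inverse mult.assoc)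
qed

text \<open>With s = 1/t one has ds/dt = - s^2, and the derivative of P(s) * exp (- s) in s is
  (P'(s) - P(s)) * exp (- s); this is the recursion of \<open>bump_poly\<close>. Only
  \<open>t = 0\<close> needs a limit, where exponential decay beats every polynomial in 1/t.\<close>

lemma bump_deriv_has_derivative: "(bump_deriv n has_real_derivative bump_deriv (Suc n) t) (at t)"
proof -
  consider "t > 0" | "t < 0" | "t = 0" by linarith
  then show ?thesis
  proof cases
    case 1
    have "((\<lambda>t. poly (bump_poly n) (1/t) * exp (- (1/t))) has_real_derivative bump_deriv (Suc n) t) (at t)"
      using 1 by (auto intro!: derivative_eq_intros poly_DERIV[THEN DERIV_chain2]
          simp: bump_deriv_def poly_monom power2_eq_square field_simps)
    moreover have "\<forall>\<^sub>F s in nhds t. bump_deriv n s = poly (bump_poly n) (1/s) * exp (- (1/s))"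
      using eventually_nhds_in_open[of "{0<..}" t] 1 by (auto simp: bump_deriv_def elim: eventually_mono)
    ultimately show ?thesis by (simp cong: DERIV_cong_ev)
  next
    case 2
    have "\<forall>\<^sub>F s in nhds t. bump_deriv n s = 0"
      using eventually_nhds_in_open[of "{..<0}" t] 2 by (auto simp: bump_deriv_def elim: eventually_mono)
    then show ?thesis using 2 by (simp add: bump_deriv_def cong: DERIV_cong_ev)
  next
    case 3
    have "((\<lambda>h. bump_deriv n h / h) \<longlongrightarrow> 0) (at_right 0)"
    proof (rule Lim_transform_eventually)
      \<comment> \<open>Dividing by \<open>h\<close> multiplies the polynomial in 1/h by one more
        factor 1/h, hence \<open>monom 1 1\<close>.\<close>
      show "((\<lambda>h. poly (monom 1 1 * bump_poly n) (inverse h) * exp (- inverse h)) \<longlongrightarrow> 0) (at_right 0)"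
        by (rule filterlim_compose[OF tendsto_poly_exp_at_top filterlim_inverse_at_top_right])
      show "\<forall>\<^sub>F h in at_right 0. poly (monom 1 1 * bump_poly n) (inverse h) * exp (- inverse h) = bump_deriv n h / h"
        by (auto simp: eventually_at_filter bump_deriv_def poly_monom divide_inverse intro!: eventuallyI)
    qed
    moreover have "((\<lambda>h. bump_deriv n h / h) \<longlongrightarrow> 0) (at_left 0)"
      by (rule Lim_transform_eventually[OF tendsto_const])
        (auto simp: eventually_at_filter bump_deriv_def intro!: eventuallyI)
    ultimately have "((\<lambda>h. bump_deriv n h / h) \<longlongrightarrow> 0) (at 0)"
      by (simp add: filterlim_at_split)
    then show ?thesis using 3 by (simp add: DERIV_def bump_deriv_def)
  qed
qed

lemma bump_bounds: "0 \<le> bump t" "bump t \<le> 1"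
  by (auto simp: bump_def bump_deriv_def)

lemma bump_eq_0_iff: "bump t = 0 \<longleftrightarrow> t \<le> 0"
  by (auto simp: bump_def bump_deriv_def)

text \<open>The shift by 1 keeps the function zero up to t = 1/n, which later gives compact support
  inside an open box. For a fixed positive t the argument still tends to infinity, where
  \<open>bump\<close> tends to 1.\<close>

lemma tendsto_bump: "(\<lambda>n. bump (real n * t - 1)) \<longlonglongrightarrow> (if t > 0 then 1 else 0)"
proof (cases "t > 0")
  case True
  have "filterlim (\<lambda>n. - 1 + t * real n) at_top sequentially"
    by (rule filterlim_tendsto_add_at_top[OF tendsto_const
        filterlim_tendsto_pos_mult_at_top[OF tendsto_const True filterlim_real_sequentially]])
  then have lim: "filterlim (\<lambda>n. real n * t - 1) at_top sequentially"
    by (simp add: algebra_simps)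
  have "(\<lambda>n. exp (- inverse (real n * t - 1))) \<longlonglongrightarrow> exp (- 0)"
    by (intro tendsto_intros tendsto_inverse_0_at_top[OF lim]) 
  then have "(\<lambda>n. exp (- inverse (real n * t - 1))) \<longlonglongrightarrow> 1" by simp
  then show ?thesis
    using True filterlim_at_top_dense[THEN iffD1, OF lim, rule_format, of 0]
    by (auto elim!: Lim_transform_eventually eventually_mono simp: bump_def bump_deriv_def divide_inverse)
next
  case False
  then have "bump (real n * t - 1) = 0" for n
    by (simp add: bump_eq_0_iff mult_nonneg_nonpos add_increasing2 order.trans[OF mult_nonneg_nonpos])
  then show ?thesis using False by simp
qed

lemma C_k_bump: "C_k k \<phi> \<Longrightarrow> C_k k (\<lambda>x. bump (\<phi> x))"
  unfolding bump_def by (rule C_k_compose[of bump_deriv, OF bump_deriv_has_derivative])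

section \<open>Test functions and smooth approximations of indicators of boxes\<close>

lemma test_functionsI:
  assumes "\<And>k. C_k k \<phi>" "compact K" "K \<subseteq> \<Omega>" "\<And>x. x \<notin> K \<Longrightarrow> \<phi> x = 0"
  shows "\<phi> \<in> test_functions \<Omega>"
proof -
  have sub: "closure {x. \<phi> x \<noteq> 0} \<subseteq> K"
    using assms by (intro closure_minimal compact_imp_closed) auto
  then have "bounded (closure {x. \<phi> x \<noteq> 0})"
    using assms(2) bounded_subset compact_imp_bounded by blast
  then show ?thesis
    using assms(1,3) sub unfolding test_functions_def compact_eq_bounded_closed by blast
qed

lemma test_functionsD:
  assumes "\<phi> \<in> test_functions \<Omega>"
  shows "C_k k \<phi>" 
    and "\<exists>K. compact K \<and> K \<subseteq> \<Omega> \<and> (\<forall>x. x \<notin> K \<longrightarrow> \<phi> x = 0)"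
proof -
  show "C_k k \<phi>" using assms by (auto simp: test_functions_def)
  show "\<exists>K. compact K \<and> K \<subseteq> \<Omega> \<and> (\<forall>x. x \<notin> K \<longrightarrow> \<phi> x = 0)"
    using assms closure_subset[of "{x. \<phi> x \<noteq> 0}"]
    by (intro exI[of _ "closure {x. \<phi> x \<noteq> 0}"] conjI allI impI) (auto simp: test_functions_def)
qed

lemma test_functions_add:
  assumes "\<phi> \<in> test_functions \<Omega>" "\<psi> \<in> test_functions \<Omega>"
  shows "(\<lambda>x. \<phi> x + \<psi> x) \<in> test_functions \<Omega>"
proof -
  obtain K where K: "compact K" "K \<subseteq> \<Omega>" "\<And>x. x \<notin> K \<Longrightarrow> \<phi> x = 0"
    using test_functionsD(2)[OF assms(1)] by blast
  obtain L where L: "compact L" "L \<subseteq> \<Omega>" "\<And>x. x \<notin> L \<Longrightarrow> \<psi> x = 0"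
    using test_functionsD(2)[OF assms(2)] by blast
  show ?thesis
    by (rule test_functionsI[of _ "K \<union> L"]) (simp_all add: C_k_add test_functionsD(1)[OF assms(1)]
      test_functionsD(1)[OF assms(2)] compact_Un K L)
qed

lemma test_functions_cmult:
  assumes "\<phi> \<in> test_functions \<Omega>"
  shows "(\<lambda>x. c * \<phi> x) \<in> test_functions \<Omega>"
proof -
  obtain K where K: "compact K" "K \<subseteq> \<Omega>" "\<And>x. x \<notin> K \<Longrightarrow> \<phi> x = 0"
    using test_functionsD(2)[OF assms(1)] by blast
  show ?thesis
    by (rule test_functionsI[of _ K]) (simp_all add: C_k_mult C_k_const test_functionsD(1)[OF assms(1)] K)
qed

lemma test_functions_0: "(\<lambda>x. 0) \<in> test_functions \<Omega>"
  by (rule test_functionsI[of _ "{}"]) (auto intro: C_k_const)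

text \<open>Two one-sided bumps per coordinate: for positive \<open>n\<close> the product is nonzero
  exactly at the points of the box whose distance from every face exceeds 1/n.\<close>

definition box_bump :: "'a::euclidean_space \<Rightarrow> 'a \<Rightarrow> nat \<Rightarrow> 'a \<Rightarrow> real" where
  "box_bump a b n x = (\<Prod>i\<in>Basis. bump (real n * (x \<bullet> i - a \<bullet> i) - 1) * bump (real n * (b \<bullet> i - x \<bullet> i) - 1))"

lemma box_bump_test_function:
  assumes "box a b \<subseteq> \<Omega>"
  shows "box_bump a b n \<in> test_functions \<Omega>"
proof (rule test_functionsI)
  \<comment> \<open>For \<open>n = 0\<close> every factor is \<open>bump (- 1) = 0\<close>, so the
    empty set serves. The general formula would read 1/0 as 0 and give the closed box, which may
    leave \<open>\<Omega>\<close>.\<close>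
  let ?K = "if n = 0 then {} else cbox (a + (1 / real n) *\<^sub>R One) (b - (1 / real n) *\<^sub>R One)"
  show "C_k k (box_bump a b n)" for k
  proof -
    have "C_k k (\<lambda>x. bump (real n * (x \<bullet> i - a \<bullet> i) - 1))" "C_k k (\<lambda>x. bump (real n * (b \<bullet> i - x \<bullet> i) - 1))" for i
      using C_k_bump[OF C_k_affine[of k "real n" i "- (real n * (a \<bullet> i)) - 1"]]
        C_k_bump[OF C_k_affine[of k "- real n" i "real n * (b \<bullet> i) - 1"]]
      by (simp_all add: algebra_simps)
    then show ?thesis unfolding box_bump_def[abs_def]
      by (intro C_k_prod C_k_mult) auto
  qed
  show "compact ?K" by simp
  have "?K \<subseteq> box a b"
    by (auto simp: mem_box algebra_simps) (smt (verit) divide_pos_pos of_nat_0_less_iff)+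
  then show "?K \<subseteq> \<Omega>" using assms by blast
  show "box_bump a b n x = 0" if x: "x \<notin> ?K" for x
  proof -
    have "\<exists>i\<in>Basis. real n * (x \<bullet> i - a \<bullet> i) \<le> 1 \<or> real n * (b \<bullet> i - x \<bullet> i) \<le> 1"
    proof (cases "n = 0")
      case False
      with x obtain i where i: "i \<in> Basis" "x \<bullet> i < a \<bullet> i + 1 / real n \<or> b \<bullet> i - 1 / real n < x \<bullet> i"
        by (auto simp: mem_box algebra_simps not_le)
      then have "real n * (x \<bullet> i - a \<bullet> i) \<le> 1 \<or> real n * (b \<bullet> i - x \<bullet> i) \<le> 1"
        using False by (auto simp: field_simps)
      with i show ?thesis by blast
    qed (use nonempty_Basis in \<open>simp add: ex_in_conv\<close>)
    then show ?thesis by (auto simp: box_bump_def bump_eq_0_iff)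
  qed
qed

lemma box_bump_bounds: "0 \<le> box_bump a b n x" "box_bump a b n x \<le> 1"
  unfolding box_bump_def by (auto intro!: prod_nonneg prod_le_1 mult_nonneg_nonneg mult_le_one bump_bounds)

lemma tendsto_box_bump: "(\<lambda>n. box_bump a b n x) \<longlonglongrightarrow> indicator (box a b) x"
proof -
  let ?p = "\<Prod>i\<in>Basis. (if x \<bullet> i - a \<bullet> i > 0 then 1 else 0) * (if b \<bullet> i - x \<bullet> i > 0 then 1 else (0 :: real))"
  have "(\<lambda>n. box_bump a b n x) \<longlonglongrightarrow> ?p"
    unfolding box_bump_def by (intro tendsto_prod tendsto_mult tendsto_bump)
  moreover have "?p = indicator (box a b) x"
  proof (cases "x \<in> box a b")
    case False
    then obtain i where "i \<in> Basis" "\<not> (a \<bullet> i < x \<bullet> i \<and> x \<bullet> i < b \<bullet> i)" by (auto simp: mem_box)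
    with False show ?thesis by (auto intro!: bexI[of _ i])
  qed (simp add: mem_box)
  ultimately show ?thesis by simp
qed

section \<open>The space L2\<close>

definition L2_inner :: "'a::euclidean_space set \<Rightarrow> ('a \<Rightarrow> 'b::euclidean_space) \<Rightarrow> ('a \<Rightarrow> 'b) \<Rightarrow> real" where
  "L2_inner \<Omega> f g = (LINT x|lebesgue_on \<Omega>. f x \<bullet> g x)"

lemma L2_measurable: "f \<in> L2 \<Omega> \<Longrightarrow> f \<in> borel_measurable (lebesgue_on \<Omega>)"
  by (simp add: L2_def)

lemma L2_integrable_norm_sq: "f \<in> L2 \<Omega> \<Longrightarrow> integrable (lebesgue_on \<Omega>) (\<lambda>x. (norm (f x))\<^sup>2)"
  by (simp add: L2_def)

lemma L2_bound:
  assumes "f \<in> borel_measurable (lebesgue_on \<Omega>)" "integrable (lebesgue_on \<Omega>) h"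
    and "\<And>x. x \<in> \<Omega> \<Longrightarrow> (norm (f x))\<^sup>2 \<le> h x"
  shows "f \<in> L2 \<Omega>"
proof -
  have "integrable (lebesgue_on \<Omega>) (\<lambda>x. (norm (f x))\<^sup>2)"
    by (rule Bochner_Integration.integrable_bound[OF assms(2)])
      (use assms in \<open>auto intro!: AE_I2 order.trans[OF assms(3)]\<close>)
  then show ?thesis using assms(1) by (simp add: L2_def)
qed

lemma L2_integrable_inner:
  assumes "f \<in> L2 \<Omega>" "g \<in> L2 \<Omega>"
  shows "integrable (lebesgue_on \<Omega>) (\<lambda>x. f x \<bullet> g x)"
proof (rule Bochner_Integration.integrable_bound)
  show "integrable (lebesgue_on \<Omega>) (\<lambda>x. (norm (f x))\<^sup>2 + (norm (g x))\<^sup>2)"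
    using assms by (intro Bochner_Integration.integrable_add L2_integrable_norm_sq)
  show "(\<lambda>x. f x \<bullet> g x) \<in> borel_measurable (lebesgue_on \<Omega>)"
    using assms by (intro borel_measurable_inner L2_measurable)
  have "norm (a \<bullet> b) \<le> norm ((norm a)\<^sup>2 + (norm b)\<^sup>2)" for a b :: 'b
  proof -
    have "\<bar>a \<bullet> b\<bar> \<le> norm a * norm b" by (rule Cauchy_Schwarz_ineq2)
    moreover have "2 * (norm a * norm b) \<le> (norm a)\<^sup>2 + (norm b)\<^sup>2"
      using sum_squares_bound[of "norm a" "norm b"] by simp
    moreover have "0 \<le> norm a * norm b" by simp
    ultimately show ?thesis by simp
  qed
  then show "AE x in lebesgue_on \<Omega>. norm (f x \<bullet> g x) \<le> norm ((norm (f x))\<^sup>2 + (norm (g x))\<^sup>2)"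
    by simp
qed

lemma L2_integrable_mult:
  "f \<in> L2 \<Omega> \<Longrightarrow> g \<in> L2 \<Omega> \<Longrightarrow> integrable (lebesgue_on \<Omega>) (\<lambda>x. f x * g x :: real)"
  using L2_integrable_inner[of f \<Omega> g] by simp

lemma L2_add:
  assumes "f \<in> L2 \<Omega>" "g \<in> L2 \<Omega>"
  shows "(\<lambda>x. f x + g x) \<in> L2 \<Omega>"
proof (rule L2_bound)
  show "integrable (lebesgue_on \<Omega>) (\<lambda>x. 2 * (norm (f x))\<^sup>2 + 2 * (norm (g x))\<^sup>2)"
    using assms by (intro Bochner_Integration.integrable_add integrable_mult_right L2_integrable_norm_sq) auto
  have "(norm (a + b))\<^sup>2 \<le> 2 * (norm a)\<^sup>2 + 2 * (norm b)\<^sup>2" for a b :: 'b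
    using power_mono[OF norm_triangle_ineq[of a b], of 2] sum_squares_bound[of "norm a" "norm b"]
    by (simp add: power2_sum)
  then show "(norm (f x + g x))\<^sup>2 \<le> 2 * (norm (f x))\<^sup>2 + 2 * (norm (g x))\<^sup>2" for x .
qed (use assms in \<open>intro borel_measurable_add L2_measurable\<close>)

lemma L2_bounded_scaleR:
  assumes "f \<in> L2 \<Omega>" "k \<in> borel_measurable (lebesgue_on \<Omega>)" "\<And>x. x \<in> \<Omega> \<Longrightarrow> \<bar>k x\<bar> \<le> c"
  shows "(\<lambda>x. k x *\<^sub>R f x) \<in> L2 \<Omega>"
proof (rule L2_bound)
  show "integrable (lebesgue_on \<Omega>) (\<lambda>x. c\<^sup>2 * (norm (f x))\<^sup>2)"
    using assms by (intro integrable_mult_right L2_integrable_norm_sq) auto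
  show "(norm (k x *\<^sub>R f x))\<^sup>2 \<le> c\<^sup>2 * (norm (f x))\<^sup>2" if "x \<in> \<Omega>" for x
    using power_mono[OF assms(3)[OF that], of 2] by (simp add: power_mult_distrib mult_right_mono)
qed (rule borel_measurable_scaleR[OF assms(2) L2_measurable[OF assms(1)]])

lemma L2_scaleR: "f \<in> L2 \<Omega> \<Longrightarrow> (\<lambda>x. c *\<^sub>R f x) \<in> L2 \<Omega>"
  by (rule L2_bounded_scaleR[of _ _ _ "\<bar>c\<bar>"]) auto

lemma L2_cmult: "f \<in> L2 \<Omega> \<Longrightarrow> (\<lambda>x. c * f x :: real) \<in> L2 \<Omega>"
  using L2_scaleR[of f \<Omega> c] by simp

lemma L2_diff: "f \<in> L2 \<Omega> \<Longrightarrow> g \<in> L2 \<Omega> \<Longrightarrow> (\<lambda>x. f x - g x) \<in> L2 \<Omega>"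
  using L2_add[of f \<Omega> "\<lambda>x. (-1) *\<^sub>R g x"] L2_scaleR[of g \<Omega> "-1"] by simp

lemma L2_component: "f \<in> L2 \<Omega> \<Longrightarrow> b \<in> Basis \<Longrightarrow> (\<lambda>x. f x \<bullet> b) \<in> L2 \<Omega>"
proof (rule L2_bound[where h="\<lambda>x. (norm (f x))\<^sup>2"])
  show "(norm (f x \<bullet> b))\<^sup>2 \<le> (norm (f x))\<^sup>2" if "b \<in> Basis" for x
    using power_mono[OF Basis_le_norm[OF that, of "f x"], of 2] by simp
qed (auto intro: L2_measurable L2_integrable_norm_sq borel_measurable_inner)

lemma L2_integrable_scaleR:
  fixes w :: "'a::euclidean_space \<Rightarrow> real" and g :: "'a \<Rightarrow> 'b::euclidean_space"
  assumes "w \<in> L2 \<Omega>" "g \<in> L2 \<Omega>"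
  shows "integrable (lebesgue_on \<Omega>) (\<lambda>x. w x *\<^sub>R g x)"
proof (rule Bochner_Integration.integrable_bound)
  show "integrable (lebesgue_on \<Omega>) (\<lambda>x. (norm (w x))\<^sup>2 + (norm (g x))\<^sup>2)"
    using assms by (intro Bochner_Integration.integrable_add L2_integrable_norm_sq)
  have "norm (a *\<^sub>R b) \<le> norm ((norm a)\<^sup>2 + (norm b)\<^sup>2)" for a :: real and b :: 'b
  proof -
    have "norm a * norm b \<le> (norm a)\<^sup>2 + (norm b)\<^sup>2"
      using sum_squares_bound[of "norm a" "norm b"] mult_nonneg_nonneg[OF norm_ge_zero[of a] norm_ge_zero[of b]]
      by linarith
    then show ?thesis by simp
  qed
  then show "AE x in lebesgue_on \<Omega>. norm (w x *\<^sub>R g x) \<le> norm ((norm (w x))\<^sup>2 + (norm (g x))\<^sup>2)"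
    by blast
qed (use assms in \<open>intro borel_measurable_scaleR L2_measurable\<close>)

section \<open>Inner product and norm\<close>

lemma L2_inner_commute: "L2_inner \<Omega> f g = L2_inner \<Omega> g f"
  by (simp add: L2_inner_def inner_commute)

lemma L2_inner_add_left:
  "f \<in> L2 \<Omega> \<Longrightarrow> g \<in> L2 \<Omega> \<Longrightarrow> h \<in> L2 \<Omega> \<Longrightarrow>
    L2_inner \<Omega> (\<lambda>x. f x + g x) h = L2_inner \<Omega> f h + L2_inner \<Omega> g h"
  by (simp add: L2_inner_def inner_add_left L2_integrable_inner)

lemma L2_inner_diff_left:
  "f \<in> L2 \<Omega> \<Longrightarrow> g \<in> L2 \<Omega> \<Longrightarrow> h \<in> L2 \<Omega> \<Longrightarrow>
    L2_inner \<Omega> (\<lambda>x. f x - g x) h = L2_inner \<Omega> f h - L2_inner \<Omega> g h"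
  by (simp add: L2_inner_def inner_diff_left L2_integrable_inner)

lemma L2_inner_scaleR_left: "L2_inner \<Omega> (\<lambda>x. c *\<^sub>R f x) h = c * L2_inner \<Omega> f h"
  by (simp add: L2_inner_def)

lemma L2_inner_add_right:
  "f \<in> L2 \<Omega> \<Longrightarrow> g \<in> L2 \<Omega> \<Longrightarrow> h \<in> L2 \<Omega> \<Longrightarrow>
    L2_inner \<Omega> h (\<lambda>x. f x + g x) = L2_inner \<Omega> h f + L2_inner \<Omega> h g"
  by (simp add: L2_inner_add_left L2_inner_commute[of _ h])

lemma L2_inner_diff_right:
  "f \<in> L2 \<Omega> \<Longrightarrow> g \<in> L2 \<Omega> \<Longrightarrow> h \<in> L2 \<Omega> \<Longrightarrow>
    L2_inner \<Omega> h (\<lambda>x. f x - g x) = L2_inner \<Omega> h f - L2_inner \<Omega> h g"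
  by (simp add: L2_inner_diff_left L2_inner_commute[of _ h])

lemma L2_inner_scaleR_right: "L2_inner \<Omega> h (\<lambda>x. c *\<^sub>R f x) = c * L2_inner \<Omega> h f"
  by (simp add: L2_inner_def)

lemma L2_norm_nonneg: "0 \<le> L2_norm \<Omega> f"
  by (simp add: L2_norm_def)

lemma L2_norm_sq: "(L2_norm \<Omega> f)\<^sup>2 = L2_inner \<Omega> f f"
  by (simp add: L2_norm_def L2_inner_def power2_norm_eq_inner)

lemma L2_norm_scaleR: "L2_norm \<Omega> (\<lambda>x. c *\<^sub>R f x) = \<bar>c\<bar> * L2_norm \<Omega> f"
  by (simp add: L2_norm_def power_mult_distrib real_sqrt_mult)

lemma L2_norm_minus_commute: "L2_norm \<Omega> (\<lambda>x. f x - g x) = L2_norm \<Omega> (\<lambda>x. g x - f x)"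
  by (simp add: L2_norm_def norm_minus_commute)

lemma L2_inner_cong_AE:
  assumes "f \<in> L2 \<Omega>" "f' \<in> L2 \<Omega>" "g \<in> L2 \<Omega>" "g' \<in> L2 \<Omega>"
    and "AE x in lebesgue_on \<Omega>. f x = f' x" "AE x in lebesgue_on \<Omega>. g x = g' x"
  shows "L2_inner \<Omega> f g = L2_inner \<Omega> f' g'"
  unfolding L2_inner_def
  by (rule integral_cong_AE) (use assms in \<open>auto intro: borel_measurable_inner L2_measurable\<close>)

lemma L2_norm_cong_AE:
  assumes "f \<in> L2 \<Omega>" "f' \<in> L2 \<Omega>" "AE x in lebesgue_on \<Omega>. f x = f' x"
  shows "L2_norm \<Omega> f = L2_norm \<Omega> f'"
  using L2_inner_cong_AE[of f \<Omega> f' f f'] assms L2_norm_sq[of \<Omega> f] L2_norm_sq[of \<Omega> f']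
    L2_norm_nonneg[of \<Omega>] by (metis power2_eq_imp_eq)

lemma L2_norm_eq_0_AE: "AE x in lebesgue_on \<Omega>. f x = 0 \<Longrightarrow> L2_norm \<Omega> f = 0"
  by (auto simp: L2_norm_def intro!: integral_eq_zero_AE)

lemma L2_norm_eq_0D:
  assumes "f \<in> L2 \<Omega>" "L2_norm \<Omega> f = 0"
  shows "AE x in lebesgue_on \<Omega>. f x = 0"
proof -
  have "AE x in lebesgue_on \<Omega>. (norm (f x))\<^sup>2 = 0"
    using assms by (subst integral_nonneg_eq_0_iff_AE[symmetric]) (auto simp: L2_norm_def L2_def)
  then show ?thesis by simp
qed

lemma L2_norm_component_le:
  assumes "f \<in> L2 \<Omega>" "b \<in> Basis"
  shows "L2_norm \<Omega> (\<lambda>x. f x \<bullet> b) \<le> L2_norm \<Omega> f"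
  unfolding L2_norm_def
proof (intro real_sqrt_le_mono integral_mono)
  show "(norm (f x \<bullet> b))\<^sup>2 \<le> (norm (f x))\<^sup>2" for x
    using power_mono[OF Basis_le_norm[OF assms(2), of "f x"], of 2] by simp
qed (use assms L2_integrable_norm_sq[OF L2_component[OF assms]] in \<open>auto intro: L2_integrable_norm_sq\<close>)

text \<open>Evaluation at the minimiser \<open>b / c\<close> gives the claim; for
  \<open>c = 0\<close> a nonzero slope would reach the value -1. Besides the Cauchy-Schwarz
  inequality, this also yields the residual estimate for near-minimisers of the Dirichlet
  functional.\<close>

lemma quadratic_nonneg_imp_discriminant:
  fixes a b c :: real
  assumes "0 \<le> c" "\<And>t. 0 \<le> a - 2 * t * b + t\<^sup>2 * c"
  shows "b\<^sup>2 \<le> a * c"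
proof (cases "c = 0")
  case True
  have "b = 0"
  proof (rule ccontr)
    assume "b \<noteq> 0"
    then show False using assms(2)[of "(a + 1) / (2 * b)"] True by (simp add: field_simps)
  qed
  then show ?thesis using True by simp
next
  case False
  with \<open>0 \<le> c\<close> have "0 < c" by simp
  then show ?thesis using assms(2)[of "b / c"] by (simp add: field_simps power2_eq_square)
qed

lemma L2_norm_sq_perturb:
  fixes X Z :: "'a::euclidean_space \<Rightarrow> real"
  assumes "X \<in> L2 \<Omega>" "Z \<in> L2 \<Omega>"
  shows "(L2_norm \<Omega> (\<lambda>x. X x + t * Z x))\<^sup>2 = (L2_norm \<Omega> X)\<^sup>2 + 2 * t * L2_inner \<Omega> X Z + t\<^sup>2 * (L2_norm \<Omega> Z)\<^sup>2"
proof -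
  have tZ: "(\<lambda>x. t *\<^sub>R Z x) \<in> L2 \<Omega>" by (rule L2_scaleR[OF assms(2)])
  have "L2_inner \<Omega> (\<lambda>x. X x + t *\<^sub>R Z x) (\<lambda>x. X x + t *\<^sub>R Z x)
      = L2_inner \<Omega> X X + t * L2_inner \<Omega> X Z + (t * L2_inner \<Omega> Z X + t * (t * L2_inner \<Omega> Z Z))"
    by (simp only: L2_inner_add_left L2_inner_add_right L2_inner_scaleR_left L2_inner_scaleR_right assms tZ L2_add distrib_left)
  then show ?thesis
    unfolding L2_norm_sq using L2_inner_commute[of \<Omega> Z X] by (simp add: power2_eq_square algebra_simps)
qed

lemma L2_Cauchy_Schwarz:
  assumes "f \<in> L2 \<Omega>" "g \<in> L2 \<Omega>"
  shows "\<bar>L2_inner \<Omega> f g\<bar> \<le> L2_norm \<Omega> f * L2_norm \<Omega> g"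
proof -
  have "0 \<le> L2_inner \<Omega> f f - 2 * t * L2_inner \<Omega> f g + t\<^sup>2 * L2_inner \<Omega> g g" for t
  proof -
    have "0 \<le> (L2_norm \<Omega> (\<lambda>x. f x - t *\<^sub>R g x))\<^sup>2" by simp
    also have "\<dots> = L2_inner \<Omega> f f - 2 * t * L2_inner \<Omega> f g + t\<^sup>2 * L2_inner \<Omega> g g"
      using assms L2_inner_commute[of \<Omega> g f] unfolding L2_norm_sq
      by (simp add: L2_inner_diff_left L2_inner_diff_right L2_inner_scaleR_left L2_inner_scaleR_right
          L2_diff L2_scaleR algebra_simps power2_eq_square)
    finally show ?thesis .
  qed
  then have "(L2_inner \<Omega> f g)\<^sup>2 \<le> (L2_norm \<Omega> f * L2_norm \<Omega> g)\<^sup>2"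
    using quadratic_nonneg_imp_discriminant[of "L2_inner \<Omega> g g"] zero_le_power2[of "L2_norm \<Omega> g"]
    unfolding power_mult_distrib L2_norm_sq by blast
  then show ?thesis
    by (metis L2_norm_nonneg abs_of_nonneg mult_nonneg_nonneg power2_le_iff_abs_le real_sqrt_abs real_sqrt_le_iff)
qed

lemma L2_norm_triangle:
  assumes "f \<in> L2 \<Omega>" "g \<in> L2 \<Omega>"
  shows "L2_norm \<Omega> (\<lambda>x. f x + g x) \<le> L2_norm \<Omega> f + L2_norm \<Omega> g"
proof (rule power2_le_imp_le)
  have "(L2_norm \<Omega> (\<lambda>x. f x + g x))\<^sup>2 = L2_inner \<Omega> f f + 2 * L2_inner \<Omega> f g + L2_inner \<Omega> g g"
    using assms L2_inner_commute[of \<Omega> g f] unfolding L2_norm_sq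
    by (simp add: L2_inner_add_left L2_inner_add_right L2_add)
  also have "\<dots> \<le> (L2_norm \<Omega> f + L2_norm \<Omega> g)\<^sup>2"
    using L2_Cauchy_Schwarz[OF assms] by (simp add: power2_sum L2_norm_sq)
  finally show "(L2_norm \<Omega> (\<lambda>x. f x + g x))\<^sup>2 \<le> (L2_norm \<Omega> f + L2_norm \<Omega> g)\<^sup>2" .
qed (simp add: L2_norm_nonneg)

lemma L2_inner_tendsto_left:
  assumes "\<And>n. f n \<in> L2 \<Omega>" "g \<in> L2 \<Omega>" "h \<in> L2 \<Omega>" "(\<lambda>n. L2_norm \<Omega> (\<lambda>x. f n x - g x)) \<longlonglongrightarrow> 0"
  shows "(\<lambda>n. L2_inner \<Omega> (f n) h) \<longlonglongrightarrow> L2_inner \<Omega> g h"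
proof -
  have "(\<lambda>n. L2_norm \<Omega> (\<lambda>x. f n x - g x) * L2_norm \<Omega> h) \<longlonglongrightarrow> 0"
    using tendsto_mult_right[OF assms(4), of "L2_norm \<Omega> h"] by simp
  then have "(\<lambda>n. L2_inner \<Omega> (f n) h - L2_inner \<Omega> g h) \<longlonglongrightarrow> 0"
  proof (rule Lim_null_comparison[rotated], intro always_eventually allI)
    show "norm (L2_inner \<Omega> (f n) h - L2_inner \<Omega> g h) \<le> L2_norm \<Omega> (\<lambda>x. f n x - g x) * L2_norm \<Omega> h" for n
      using L2_Cauchy_Schwarz[of "\<lambda>x. f n x - g x" \<Omega> h] assms by (simp add: L2_inner_diff_left L2_diff)
  qed
  then show ?thesis by (simp add: LIM_zero_iff)
qed

section \<open>Completeness\<close>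

lemma convergent_of_summable_weighted_squares:
  fixes f :: "nat \<Rightarrow> 'b::banach"
  assumes "summable (\<lambda>n. 2 ^ n * (norm (f (Suc n) - f n))\<^sup>2)"
  shows "convergent f"
proof -
  \<comment> \<open>The inequality z \<le> 1 + z^2 at z = 2^n * d, divided by 2^n. It turns
    summability of the weighted squares into absolute summability of the increments.\<close>
  have "norm (f (Suc n) - f n) \<le> (1/2) ^ n + 2 ^ n * (norm (f (Suc n) - f n))\<^sup>2" for n
  proof -
    let ?d = "norm (f (Suc n) - f n)" and ?q = "2 ^ n :: real"
    have "z \<le> 1 + z\<^sup>2" if "0 \<le> z" for z :: real
      using that sum_squares_bound[of 1 z] by simp
    then have *: "?q * ?d \<le> 1 + (?q * ?d)\<^sup>2" by simp
    have "?q * ?d \<le> ?q * ((1/2) ^ n + ?q * ?d\<^sup>2)"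
    proof -
      have "?q * (1/2) ^ n = 1" by (simp add: power_divide)
      moreover have "?q * (?q * ?d\<^sup>2) = (?q * ?d)\<^sup>2" by (simp add: power2_eq_square)
      ultimately show ?thesis unfolding distrib_left using * by linarith
    qed
    then show ?thesis by (rule mult_left_le_imp_le) simp
  qed
  moreover have "summable (\<lambda>n. (1/2) ^ n + 2 ^ n * (norm (f (Suc n) - f n))\<^sup>2)"
    by (intro summable_add[OF summable_geometric assms]) simp
  ultimately have "summable (\<lambda>n. f (Suc n) - f n)"
    by (intro summable_comparison_test'[of _ 0 "\<lambda>n. f (Suc n) - f n"])
  then have "(\<lambda>n. f 0 + (\<Sum>k<n. f (Suc k) - f k)) \<longlonglongrightarrow> f 0 + (\<Sum>k. f (Suc k) - f k)"
    by (intro tendsto_intros summable_LIMSEQ)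
  then have "f \<longlonglongrightarrow> f 0 + (\<Sum>k. f (Suc k) - f k)"
    unfolding sum_lessThan_telescope by simp
  then show ?thesis by (rule convergentI)
qed

lemma nn_integral_norm_sq:
  "f \<in> L2 \<Omega> \<Longrightarrow> (\<integral>\<^sup>+x. ennreal ((norm (f x))\<^sup>2) \<partial>lebesgue_on \<Omega>) = ennreal ((L2_norm \<Omega> f)\<^sup>2)"
  by (simp add: L2_norm_def nn_integral_eq_integral L2_integrable_norm_sq)

text \<open>The weighted square of the n-th increment has integral at most 2^n * 4^(-n) = 2^(-n).
  The sum of these integrals is finite, so the series of weighted squares is finite almost
  everywhere.\<close>

lemma AE_convergent_of_fast_Cauchy:
  assumes f: "\<And>n. f n \<in> L2 \<Omega>"
    and fast: "\<And>n. L2_norm \<Omega> (\<lambda>x. f (Suc n) x - f n x) \<le> (1/2) ^ n"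
  shows "AE x in lebesgue_on \<Omega>. convergent (\<lambda>n. f n x)"
proof -
  let ?M = "lebesgue_on \<Omega>"
  let ?d = "\<lambda>n x. 2 ^ n * (norm (f (Suc n) x - f n x))\<^sup>2"
  have meas [measurable]: "f n \<in> borel_measurable ?M" for n
    by (rule L2_measurable[OF f])
  have "(\<integral>\<^sup>+x. ennreal (?d n x) \<partial>?M) \<le> ennreal ((1/2) ^ n)" for n
  proof -
    have "(\<integral>\<^sup>+x. ennreal (?d n x) \<partial>?M) = ennreal (2 ^ n * (L2_norm \<Omega> (\<lambda>x. f (Suc n) x - f n x))\<^sup>2)"
      using nn_integral_norm_sq[OF L2_diff[OF f f], of "Suc n" n]
      by (simp add: ennreal_mult nn_integral_cmult)
    also have "\<dots> \<le> ennreal (2 ^ n * ((1/2) ^ n)\<^sup>2)"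
      by (intro ennreal_leI mult_left_mono power_mono fast) (simp_all add: L2_norm_nonneg)
    also have "2 ^ n * ((1/2) ^ n)\<^sup>2 = ((1/2) ^ n :: real)"
      by (simp add: power2_eq_square power_divide)
    finally show ?thesis .
  qed
  then have "(\<integral>\<^sup>+x. (\<Sum>n. ennreal (?d n x)) \<partial>?M) \<le> (\<Sum>n. ennreal ((1/2) ^ n))"
    by (subst nn_integral_suminf) (auto intro!: suminf_le)
  also have "\<dots> < \<infinity>"
    by (subst suminf_ennreal2) (auto intro: summable_geometric)
  finally have "AE x in ?M. (\<Sum>n. ennreal (?d n x)) \<noteq> \<infinity>"
    by (intro nn_integral_PInf_AE) auto
  then show ?thesis
  proof eventually_elim
    case (elim x)
    then have "summable (\<lambda>n. ?d n x)"
      by (intro summable_suminf_not_top) (auto simp: top_unique)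
    then show ?case by (rule convergent_of_summable_weighted_squares)
  qed
qed

text \<open>Fatou's lemma for the squared norms. A bound on a tail is enough because a lower limit
  ignores finitely many terms; this form lets a Cauchy estimate pass to the limit in one
  argument.\<close>

lemma L2_Fatou:
  assumes f: "\<And>n. f n \<in> L2 \<Omega>" and g: "g \<in> borel_measurable (lebesgue_on \<Omega>)"
    and lim: "AE x in lebesgue_on \<Omega>. (\<lambda>n. f n x) \<longlonglongrightarrow> g x"
    and le: "\<And>n. n \<ge> N \<Longrightarrow> L2_norm \<Omega> (f n) \<le> e"
  shows "g \<in> L2 \<Omega>" "L2_norm \<Omega> g \<le> e"
proof -
  let ?M = "lebesgue_on \<Omega>"
  have e: "0 \<le> e" using le[of N] L2_norm_nonneg[of \<Omega> "f N"] by simp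
  note [measurable] = g L2_measurable[OF f]
  have "(\<integral>\<^sup>+x. ennreal ((norm (g x))\<^sup>2) \<partial>?M) = (\<integral>\<^sup>+x. liminf (\<lambda>n. ennreal ((norm (f n x))\<^sup>2)) \<partial>?M)"
  proof (rule nn_integral_cong_AE)
    show "AE x in ?M. ennreal ((norm (g x))\<^sup>2) = liminf (\<lambda>n. ennreal ((norm (f n x))\<^sup>2))"
      using lim
    proof eventually_elim
      case (elim x)
      then have "(\<lambda>n. ennreal ((norm (f n x))\<^sup>2)) \<longlonglongrightarrow> ennreal ((norm (g x))\<^sup>2)"
        by (intro tendsto_intros) auto
      then show ?case 
        by (intro lim_imp_Liminf[symmetric]) simp_all
    qed
  qed
  also have "\<dots> \<le> liminf (\<lambda>n. \<integral>\<^sup>+x. ennreal ((norm (f n x))\<^sup>2) \<partial>?M)"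
    by (rule nn_integral_liminf) measurable
  also have "\<dots> = liminf (\<lambda>n. ennreal ((L2_norm \<Omega> (f n))\<^sup>2))"
    by (simp add: nn_integral_norm_sq f)
  also have "\<dots> \<le> liminf (\<lambda>n. ennreal (e\<^sup>2))"
    by (intro Liminf_mono eventually_sequentiallyI[of N] ennreal_leI power_mono le L2_norm_nonneg)
  also have "\<dots> = ennreal (e\<^sup>2)" by (simp add: Liminf_const)
  finally have *: "(\<integral>\<^sup>+x. ennreal ((norm (g x))\<^sup>2) \<partial>?M) \<le> ennreal (e\<^sup>2)" .
  then show gL2: "g \<in> L2 \<Omega>"
    using g by (auto simp: L2_def integrable_iff_bounded order.strict_trans1)
  have "(L2_norm \<Omega> g)\<^sup>2 \<le> e\<^sup>2"
    using * nn_integral_norm_sq[OF gL2] by simp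
  then show "L2_norm \<Omega> g \<le> e"
    using e by (rule power2_le_imp_le)
qed

lemma L2_complete:
  assumes f: "\<And>n. f n \<in> L2 \<Omega>"
    and Cauchy: "\<And>e. e > 0 \<Longrightarrow> \<exists>N. \<forall>m\<ge>N. \<forall>n\<ge>N. L2_norm \<Omega> (\<lambda>x. f m x - f n x) \<le> e"
  obtains g where "g \<in> L2 \<Omega>" "(\<lambda>n. L2_norm \<Omega> (\<lambda>x. f n x - g x)) \<longlonglongrightarrow> 0"
proof -
  have "\<exists>N. \<forall>k. \<forall>m\<ge>N k. \<forall>n\<ge>N k. L2_norm \<Omega> (\<lambda>x. f m x - f n x) \<le> (1/2) ^ k"
    using Cauchy by (intro choice allI) simp
  then obtain N where N: "\<And>k m n. m \<ge> N k \<Longrightarrow> n \<ge> N k \<Longrightarrow> L2_norm \<Omega> (\<lambda>x. f m x - f n x) \<le> (1/2) ^ k"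
    by blast
  \<comment> \<open>Summing all earlier \<open>N j\<close> makes \<open>r\<close> monotone and at
    least \<open>N k\<close>; the extra \<open>k\<close> forces it to infinity, so that a bound for
    all large indices applies along the subsequence.\<close>
  define r where "r k = (\<Sum>j\<le>k. N j) + k" for k
  have rN: "N k \<le> r k" and r_le: "r k \<le> r (Suc k)" and r_ge: "k \<le> r k" for k
    by (auto simp: r_def intro: trans_le_add1 member_le_sum)
  have conv: "AE x in lebesgue_on \<Omega>. convergent (\<lambda>k. f (r k) x)"
    by (rule AE_convergent_of_fast_Cauchy[OF f]) (intro N order.trans[OF rN r_le] rN)
  define g where "g x = lim (\<lambda>k. f (r k) x)" for x
  have lim: "AE x in lebesgue_on \<Omega>. (\<lambda>k. f (r k) x) \<longlonglongrightarrow> g x"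
    using conv by eventually_elim (simp add: g_def convergent_LIMSEQ_iff)
  have g: "g \<in> borel_measurable (lebesgue_on \<Omega>)"
    unfolding g_def by (intro borel_measurable_lim_metric L2_measurable f)
  \<comment> \<open>Fatou's lemma with \<open>n\<close> fixed, along the almost everywhere
    convergent subsequence, extends the Cauchy bound to the whole sequence against the limit
    \<open>g\<close>.\<close>
  have approx: "(\<lambda>x. f n x - g x) \<in> L2 \<Omega> \<and> L2_norm \<Omega> (\<lambda>x. f n x - g x) \<le> e"
    if "\<And>m. m \<ge> K \<Longrightarrow> L2_norm \<Omega> (\<lambda>x. f n x - f m x) \<le> e" for n K e
  proof -
    have "AE x in lebesgue_on \<Omega>. (\<lambda>k. f n x - f (r k) x) \<longlonglongrightarrow> f n x - g x"
      using lim by eventually_elim (intro tendsto_intros)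
    then show ?thesis
      using L2_Fatou[of "\<lambda>k x. f n x - f (r k) x" \<Omega> "\<lambda>x. f n x - g x" K e, OF L2_diff[OF f f]
          borel_measurable_diff[OF L2_measurable[OF f] g] _ that[OF order.trans[OF _ r_ge]]]
      by blast
  qed
  show thesis
  proof (rule that)
    obtain K where "\<forall>m\<ge>K. \<forall>n\<ge>K. L2_norm \<Omega> (\<lambda>x. f m x - f n x) \<le> 1"
      using Cauchy[of 1] by auto
    then have "(\<lambda>x. f K x - g x) \<in> L2 \<Omega>"
      using approx[of K K 1] by auto
    from L2_diff[OF f[of K] this] show "g \<in> L2 \<Omega>" by simp
    show "(\<lambda>n. L2_norm \<Omega> (\<lambda>x. f n x - g x)) \<longlonglongrightarrow> 0"
    proof (rule LIMSEQ_I)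
      fix e :: real assume "0 < e"
      then obtain K where "\<forall>m\<ge>K. \<forall>n\<ge>K. L2_norm \<Omega> (\<lambda>x. f m x - f n x) \<le> e / 2"
        using Cauchy[of "e / 2"] by auto
      then have "\<forall>n\<ge>K. L2_norm \<Omega> (\<lambda>x. f n x - g x) \<le> e / 2"
        using approx[of K _ "e / 2"] by auto
      then show "\<exists>no. \<forall>n\<ge>no. norm (L2_norm \<Omega> (\<lambda>x. f n x - g x) - 0) < e"
        using \<open>0 < e\<close> by (intro exI[of _ K]) (auto simp: L2_norm_nonneg intro: order.strict_trans1)
    qed
  qed
qed

section \<open>Integration by parts and the fundamental lemma\<close>

lemma has_derivative_0_outside:
  fixes h :: "'a::euclidean_space \<Rightarrow> real"
  assumes "compact K" "\<And>y. y \<notin> K \<Longrightarrow> h y = 0" "x \<notin> K"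
  shows "frechet_derivative h (at x) = (\<lambda>_. 0)"
proof -
  have "(h has_derivative (\<lambda>_. 0)) (at x)"
    by (rule has_derivative_transform_within_open[of "\<lambda>_. 0" _ _ UNIV "- K"])
      (use assms in \<open>auto simp: compact_imp_closed open_Compl\<close>)
  then show ?thesis by (simp add: frechet_derivative_at[symmetric])
qed

lemma integrable_lborel_compact_support:
  fixes f :: "'a::euclidean_space \<Rightarrow> 'b::euclidean_space"
  assumes "continuous_on UNIV f" "compact K" "\<And>x. x \<notin> K \<Longrightarrow> f x = 0"
  shows "integrable lborel f"
proof -
  have "integrable lborel (\<lambda>x. indicator K x *\<^sub>R f x)"
    using assms by (intro borel_integrable_compact) (auto intro: continuous_on_subset)
  moreover have "(\<lambda>x. indicator K x *\<^sub>R f x) = f"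
    using assms(3) by (auto simp: indicator_def)
  ultimately show ?thesis by simp
qed

lemma continuous_measurable_lebesgue_on:
  fixes f :: "'a::euclidean_space \<Rightarrow> 'b::euclidean_space"
  assumes "continuous_on UNIV f"
  shows "f \<in> borel_measurable (lebesgue_on \<Omega>)"
  using assms by (intro measurable_restrict_space1 measurable_completion)
    (simp add: borel_measurable_continuous_onI)

text \<open>Moves integrals of compactly supported functions from \<open>\<Omega>\<close> to the
  whole space, where translation invariance is available, and from the completed measure to
  \<open>lborel\<close>.\<close>

lemma integral_lebesgue_on_compact_support:
  fixes f :: "'a::euclidean_space \<Rightarrow> 'b::euclidean_space"
  assumes \<Omega>: "\<Omega> \<in> sets lebesgue"
    and f: "continuous_on UNIV f" "compact K" "\<And>x. x \<notin> K \<Longrightarrow> f x = 0"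
  shows "integrable (lebesgue_on \<Omega>) f"
    and "K \<subseteq> \<Omega> \<Longrightarrow> (LINT x|lebesgue_on \<Omega>. f x) = (LINT x|lborel. f x)"
proof -
  have meas: "f \<in> borel_measurable lborel"
    using f(1) by (simp add: borel_measurable_continuous_onI)
  have int: "integrable lebesgue f"
    using integrable_lborel_compact_support[OF f] integrable_completion[OF meas] by simp
  then show "integrable (lebesgue_on \<Omega>) f"
    using \<Omega> by (simp add: integrable_restrict_space integrable_mult_indicator)
  show "(LINT x|lebesgue_on \<Omega>. f x) = (LINT x|lborel. f x)" if "K \<subseteq> \<Omega>"
  proof -
    have "(\<lambda>x. indicator \<Omega> x *\<^sub>R f x) = f"
      using f(3) that by (auto simp: fun_eq_iff split: split_indicator)
    then show ?thesis
      using \<Omega> by (simp add: integral_restrict_space integral_completion[OF meas])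
  qed
qed

lemma C_1_partial_derivative:
  fixes h :: "'a::euclidean_space \<Rightarrow> real"
  assumes h: "C_k (Suc 0) h"
  shows "((\<lambda>s. h (x + s *\<^sub>R b)) has_real_derivative frechet_derivative h (at (x + s *\<^sub>R b)) b) (at s)"
proof -
  have "((\<lambda>s. x + s *\<^sub>R b) has_derivative (\<lambda>s. s *\<^sub>R b)) (at s)"
    by (auto intro!: derivative_eq_intros)
  from has_derivative_compose[OF this C_k_SucD(1)[OF h]]
  have "((\<lambda>s. h (x + s *\<^sub>R b)) has_derivative (\<lambda>r. frechet_derivative h (at (x + s *\<^sub>R b)) (r *\<^sub>R b))) (at s)" .
  moreover have "frechet_derivative h (at (x + s *\<^sub>R b)) (r *\<^sub>R b) = frechet_derivative h (at (x + s *\<^sub>R b)) b * r" for r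
    using linear_scale[OF has_derivative_linear[OF C_k_SucD(1)[OF h]]] by simp
  ultimately show ?thesis by (simp add: has_field_derivative_def)
qed

lemma C_1_increment_le:
  fixes h :: "'a::euclidean_space \<Rightarrow> real"
  assumes h: "C_k (Suc 0) h" and L: "\<And>x. \<bar>frechet_derivative h (at x) b\<bar> \<le> L" and t: "t > 0"
  shows "\<bar>h (x + t *\<^sub>R b) - h x\<bar> \<le> t * L"
proof -
  obtain z where "h (x + t *\<^sub>R b) - h (x + 0 *\<^sub>R b) = (t - 0) * frechet_derivative h (at (x + z *\<^sub>R b)) b"
    using MVT2[OF t C_1_partial_derivative[OF h]] by blast
  then show ?thesis
    using L t by (simp add: abs_mult)
qed

text \<open>By translation invariance all difference quotients of \<open>h\<close> have integral zero.\<close>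

lemma integral_partial_derivative_eq_0:
  fixes h :: "'a::euclidean_space \<Rightarrow> real"
  assumes h: "C_k (Suc 0) h" and K: "compact K" "\<And>x. x \<notin> K \<Longrightarrow> h x = 0" and b: "b \<in> Basis"
  shows "(LINT x|lborel. frechet_derivative h (at x) b) = 0"
proof -
  define D where "D x = frechet_derivative h (at x) b" for x
  have contD: "continuous_on UNIV D"
    unfolding D_def using C_k_SucD(2)[OF h b] by simp
  have D0: "D x = 0" if "x \<notin> K" for x
    using has_derivative_0_outside[OF K that] by (simp add: D_def)
  obtain L where L: "L > 0" "\<And>x. x \<in> K \<Longrightarrow> \<bar>D x\<bar> \<le> L"
    using compact_imp_bounded[OF compact_continuous_image[OF continuous_on_subset[OF contD subset_UNIV] K(1)]]
    by (auto simp: bounded_pos)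
  then have DL: "\<bar>D x\<bar> \<le> L" for x
    using D0[of x] by (cases "x \<in> K") auto
  obtain R where R: "\<And>x. x \<in> K \<Longrightarrow> norm x \<le> R"
    using compact_imp_bounded[OF K(1)] by (auto simp: bounded_iff)
  define s where "s n = inverse (real (Suc n))" for n
  have s: "s n > 0" "s n \<le> 1" for n by (auto simp: s_def field_simps)
  define q where "q n x = (h (x + s n *\<^sub>R b) - h x) / s n" for n x
  have h_meas: "h \<in> borel_measurable borel"
    using C_k_continuous[OF h] by (rule borel_measurable_continuous_onI)
  have h_int: "integrable lborel h"
    by (rule integrable_lborel_compact_support[OF C_k_continuous[OF h] K])
  have shift: "integrable lborel (\<lambda>x. h (x + c))" "(LINT x|lborel. h (x + c)) = (LINT x|lborel. h x)" for c
    using integrable_distr[of "(+) c" lborel borel h] integral_distr[of "(+) c" lborel borel h] h_int h_meas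
    by (simp_all add: lborel_distr_plus add.commute)
  have "(LINT x|lborel. q n x) = 0" for n
    using shift h_int by (simp add: q_def)
  moreover have "(\<lambda>n. LINT x|lborel. q n x) \<longlonglongrightarrow> (LINT x|lborel. D x)"
  proof (rule integral_dominated_convergence)
    show "D \<in> borel_measurable lborel"
      using contD by (simp add: borel_measurable_continuous_onI)
    show "q n \<in> borel_measurable lborel" for n
      unfolding q_def using borel_measurable_integrable[OF shift(1)] h_meas by simp
    \<comment> \<open>By the mean value theorem each quotient is bounded by \<open>L\<close>; as the
      steps \<open>s n\<close> are at most 1, all quotients vanish outside the ball of radius
      \<open>R + 1\<close>.\<close>
    show "integrable lborel (\<lambda>x. L * indicator (cball 0 (R + 1)) x :: real)"
      by (intro integrable_mult_right integrable_real_indicator emeasure_lborel_cball_finite) simp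
    show "AE x in lborel. norm (q n x) \<le> L * indicator (cball 0 (R + 1)) x" for n
    proof (intro AE_I2)
      fix x
      show "norm (q n x) \<le> L * indicator (cball 0 (R + 1)) x"
      proof (cases "x \<in> cball 0 (R + 1)")
        case True
        have "\<bar>h (x + s n *\<^sub>R b) - h x\<bar> \<le> s n * L"
          by (rule C_1_increment_le[OF h DL[unfolded D_def] s(1)])
        then show ?thesis
          using True s[of n] by (simp add: q_def field_simps)
      next
        case False
        then have x: "norm x > R + 1" by simp
        have "norm x \<le> norm (x + s n *\<^sub>R b) + norm (s n *\<^sub>R b)"
          using norm_triangle_ineq4[of "x + s n *\<^sub>R b" "s n *\<^sub>R b"] by simp
        then have "norm (x + s n *\<^sub>R b) > R"
          using x s[of n] b by simp
        then have "x \<notin> K" "x + s n *\<^sub>R b \<notin> K" using R x by fastforce+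
        then show ?thesis using K(2) L by (simp add: q_def)
      qed
    qed
    show "AE x in lborel. (\<lambda>n. q n x) \<longlonglongrightarrow> D x"
    proof (intro AE_I2)
      fix x
      have "((\<lambda>r. (h (x + r *\<^sub>R b) - h x) / r) \<longlongrightarrow> D x) (at 0)"
        using C_1_partial_derivative[OF h, of x b 0] by (simp add: DERIV_def D_def)
      moreover have "filterlim s (at 0) sequentially"
        unfolding filterlim_at using s LIMSEQ_inverse_real_of_nat by (auto simp: s_def[abs_def] intro!: always_eventually)
      ultimately show "(\<lambda>n. q n x) \<longlonglongrightarrow> D x"
        unfolding q_def by (rule filterlim_compose)
    qed
  qed
  ultimately have "(\<lambda>n. 0) \<longlonglongrightarrow> (LINT x|lborel. D x)" by simp
  then have "(LINT x|lborel. D x) = 0" by (simp add: LIMSEQ_const_iff)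
  then show ?thesis by (simp add: D_def)
qed

section \<open>Gradients of test functions and integration by parts\<close>

lemma classical_grad_inner: "b \<in> Basis \<Longrightarrow> classical_grad \<phi> x \<bullet> b = frechet_derivative \<phi> (at x) b"
  by (simp add: classical_grad_def inner_sum_left_Basis)

lemma test_function_support:
  assumes "\<phi> \<in> test_functions \<Omega>"
  obtains K where "compact K" "K \<subseteq> \<Omega>" "\<And>x. x \<notin> K \<Longrightarrow> \<phi> x = 0" "\<And>x. x \<notin> K \<Longrightarrow> classical_grad \<phi> x = 0"
proof -
  obtain K where K: "compact K" "K \<subseteq> \<Omega>" "\<And>x. x \<notin> K \<Longrightarrow> \<phi> x = 0"
    using test_functionsD(2)[OF assms] by blast
  show thesis
    by (rule that[OF K]) (simp_all add: classical_grad_def has_derivative_0_outside[OF K(1,3)])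
qed

lemma continuous_test_function: "\<phi> \<in> test_functions \<Omega> \<Longrightarrow> continuous_on UNIV \<phi>"
  by (rule C_k_continuous[OF test_functionsD(1)[of _ _ 0]])

lemma continuous_classical_grad:
  assumes "\<phi> \<in> test_functions \<Omega>"
  shows "continuous_on UNIV (classical_grad \<phi>)"
  unfolding classical_grad_def
  using C_k_SucD(2)[OF test_functionsD(1)[OF assms, of "Suc 0"]]
  by (intro continuous_on_sum continuous_on_scaleR continuous_on_const) simp

lemma classical_grad_add:
  assumes "\<phi> \<in> test_functions \<Omega>" "\<psi> \<in> test_functions \<Omega>"
  shows "classical_grad (\<lambda>x. \<phi> x + \<psi> x) x = classical_grad \<phi> x + classical_grad \<psi> x"
proof -
  note D = C_k_SucD(1)[OF test_functionsD(1)[OF assms(1), of "Suc 0"], of x]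
    C_k_SucD(1)[OF test_functionsD(1)[OF assms(2), of "Suc 0"], of x]
  show ?thesis
    unfolding classical_grad_def frechet_derivative_at[OF has_derivative_add[OF D], symmetric]
    by (simp add: scaleR_add_left sum.distrib)
qed

lemma classical_grad_cmult:
  assumes "\<phi> \<in> test_functions \<Omega>"
  shows "classical_grad (\<lambda>x. c * \<phi> x) x = c *\<^sub>R classical_grad \<phi> x"
proof -
  note D = C_k_SucD(1)[OF test_functionsD(1)[OF assms, of "Suc 0"], of x]
  show ?thesis
    unfolding classical_grad_def frechet_derivative_at[OF has_derivative_mult_right[OF D, of c], symmetric]
    by (simp add: scaleR_sum_right)
qed

lemma classical_grad_diff:
  assumes "\<phi> \<in> test_functions \<Omega>" "\<psi> \<in> test_functions \<Omega>"
  shows "(\<lambda>x. \<phi> x - \<psi> x) \<in> test_functions \<Omega>"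
    and "classical_grad (\<lambda>x. \<phi> x - \<psi> x) x = classical_grad \<phi> x - classical_grad \<psi> x"
  using test_functions_add[OF assms(1) test_functions_cmult[OF assms(2), of "-1"]]
    classical_grad_add[OF assms(1) test_functions_cmult[OF assms(2), of "-1"], of x]
    classical_grad_cmult[OF assms(2), of "-1" x] by simp_all

lemma L2_compact_support:
  fixes f :: "'a::euclidean_space \<Rightarrow> 'b::euclidean_space"
  assumes "\<Omega> \<in> sets lebesgue" "continuous_on UNIV f" "compact K" "\<And>x. x \<notin> K \<Longrightarrow> f x = 0"
  shows "f \<in> L2 \<Omega>"
proof -
  have "integrable (lebesgue_on \<Omega>) (\<lambda>x. (norm (f x))\<^sup>2)"
    using assms by (intro integral_lebesgue_on_compact_support(1)[of _ _ K] continuous_intros) auto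
  then show ?thesis
    using continuous_measurable_lebesgue_on[OF assms(2)] by (simp add: L2_def)
qed

lemma test_function_L2:
  assumes "\<Omega> \<in> sets lebesgue" "\<phi> \<in> test_functions \<Omega>"
  shows "\<phi> \<in> L2 \<Omega>" "classical_grad \<phi> \<in> L2 \<Omega>"
proof -
  obtain K where K: "compact K" "K \<subseteq> \<Omega>" "\<And>x. x \<notin> K \<Longrightarrow> \<phi> x = 0" "\<And>x. x \<notin> K \<Longrightarrow> classical_grad \<phi> x = 0"
    using test_function_support[OF assms(2)] by blast
  show "\<phi> \<in> L2 \<Omega>"
    by (rule L2_compact_support[OF assms(1) continuous_test_function[OF assms(2)] K(1,3)])
  show "classical_grad \<phi> \<in> L2 \<Omega>"
    by (rule L2_compact_support[OF assms(1) continuous_classical_grad[OF assms(2)] K(1,4)])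
qed

text \<open>The product rule splits the partial derivative of \<phi> * \<psi>, whose integral over
  the whole space is zero. The support of \<phi> alone already confines the integrand to
  \<open>\<Omega>\<close>.\<close>

lemma test_function_integration_by_parts:
  assumes \<Omega>: "\<Omega> \<in> sets lebesgue" and \<phi>: "\<phi> \<in> test_functions \<Omega>" and \<psi>: "\<psi> \<in> test_functions \<Omega>" and b: "b \<in> Basis"
  shows "L2_inner \<Omega> \<phi> (\<lambda>x. classical_grad \<psi> x \<bullet> b) = - L2_inner \<Omega> \<psi> (\<lambda>x. classical_grad \<phi> x \<bullet> b)"
proof -
  obtain K where K: "compact K" "K \<subseteq> \<Omega>" "\<And>x. x \<notin> K \<Longrightarrow> \<phi> x = 0" "\<And>x. x \<notin> K \<Longrightarrow> classical_grad \<phi> x = 0"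
    using test_function_support[OF \<phi>] by blast
  let ?h = "\<lambda>x. \<phi> x * \<psi> x"
  have C1: "C_k (Suc 0) ?h"
    by (intro C_k_mult test_functionsD(1)[OF \<phi>] test_functionsD(1)[OF \<psi>])
  have "frechet_derivative ?h (at x) b = \<phi> x * (classical_grad \<psi> x \<bullet> b) + \<psi> x * (classical_grad \<phi> x \<bullet> b)" for x
    unfolding frechet_derivative_at[OF has_derivative_mult[OF C_k_SucD(1)[OF test_functionsD(1)[OF \<phi>, of "Suc 0"], of x]
          C_k_SucD(1)[OF test_functionsD(1)[OF \<psi>, of "Suc 0"], of x]], symmetric]
    using b by (simp add: classical_grad_inner mult.commute)
  moreover have "(LINT x|lebesgue_on \<Omega>. \<phi> x * (classical_grad \<psi> x \<bullet> b) + \<psi> x * (classical_grad \<phi> x \<bullet> b)) =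
      (LINT x|lborel. \<phi> x * (classical_grad \<psi> x \<bullet> b) + \<psi> x * (classical_grad \<phi> x \<bullet> b))"
    using \<Omega> K by (intro integral_lebesgue_on_compact_support(2)[of _ _ K])
      (auto intro!: continuous_intros continuous_test_function[OF \<phi>] continuous_test_function[OF \<psi>]
        continuous_classical_grad[OF \<phi>] continuous_classical_grad[OF \<psi>])
  ultimately have "(LINT x|lebesgue_on \<Omega>. \<phi> x * (classical_grad \<psi> x \<bullet> b) + \<psi> x * (classical_grad \<phi> x \<bullet> b)) = 0"
    using integral_partial_derivative_eq_0[OF C1 K(1) _ b] K(3) by simp
  moreover have "integrable (lebesgue_on \<Omega>) (\<lambda>x. \<phi> x * (classical_grad \<psi> x \<bullet> b))"
      "integrable (lebesgue_on \<Omega>) (\<lambda>x. \<psi> x * (classical_grad \<phi> x \<bullet> b))"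
    by (rule L2_integrable_mult[OF test_function_L2(1)[OF \<Omega>] L2_component[OF test_function_L2(2)[OF \<Omega>] b]],
        fact, fact)+
  ultimately show ?thesis by (simp add: L2_inner_def)
qed

section \<open>The fundamental lemma of the calculus of variations\<close>

lemma integral_over_box_eq_0:
  assumes g: "integrable (lebesgue_on \<Omega>) g"
    and test: "\<And>\<phi>. \<phi> \<in> test_functions \<Omega> \<Longrightarrow> (LINT x|lebesgue_on \<Omega>. \<phi> x * g x) = (0::real)"
    and box: "box a b \<subseteq> \<Omega>"
  shows "(LINT x|lebesgue_on \<Omega>. indicator (box a b) x * g x) = 0"
proof -
  have "(\<lambda>n. LINT x|lebesgue_on \<Omega>. box_bump a b n x * g x) \<longlonglongrightarrow> (LINT x|lebesgue_on \<Omega>. indicator (box a b) x * g x)"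
  proof (rule integral_dominated_convergence)
    have "box a b \<in> sets (lebesgue_on \<Omega>)"
      unfolding sets_restrict_space by (rule image_eqI[of _ _ "box a b"]) (use box in auto)
    then show "(\<lambda>x. indicator (box a b) x * g x) \<in> borel_measurable (lebesgue_on \<Omega>)"
      by (intro borel_measurable_times borel_measurable_indicator borel_measurable_integrable[OF g])
    show "(\<lambda>x. box_bump a b n x * g x) \<in> borel_measurable (lebesgue_on \<Omega>)" for n
      by (rule borel_measurable_times[OF continuous_measurable_lebesgue_on[OF
          continuous_test_function[OF box_bump_test_function[OF box]]] borel_measurable_integrable[OF g]])
    show "integrable (lebesgue_on \<Omega>) (\<lambda>x. \<bar>g x\<bar>)" using g by simp
    show "AE x in lebesgue_on \<Omega>. (\<lambda>n. box_bump a b n x * g x) \<longlonglongrightarrow> indicator (box a b) x * g x"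
      by (intro AE_I2 tendsto_intros tendsto_box_bump)
    show "AE x in lebesgue_on \<Omega>. norm (box_bump a b n x * g x) \<le> \<bar>g x\<bar>" for n
      using box_bump_bounds[of a b n] by (intro AE_I2) (simp add: abs_mult mult_left_le_one_le)
  qed
  then show ?thesis
    using test[OF box_bump_test_function[OF box]] by (simp add: LIMSEQ_const_iff)
qed

text \<open>Boxes form an intersection-stable generator of the Borel sets, so the vanishing of set
  integrals spreads from boxes to all Borel sets. Concentration of \<open>g\<close> on one box makes
  its total integral zero, which the complement step needs, and lets an arbitrary box be cut down to
  a subset of that box.\<close>

lemma AE_eq_0_of_box_integrals:
  fixes g :: "'a::euclidean_space \<Rightarrow> real"
  assumes g: "integrable lborel g" and Q: "\<And>x. x \<notin> box a b \<Longrightarrow> g x = 0"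
    and box: "\<And>c d. box c d \<subseteq> box a b \<Longrightarrow> (LINT x|lborel. indicator (box c d) x * g x) = 0"
  shows "AE x in lborel. g x = 0"
proof (rule sigma_finite_measure.density_zero[OF sigma_finite_lborel g])
  have int: "set_integrable lborel A g" if "A \<in> sets lborel" for A
    using integrable_mult_indicator[OF that g] by (simp add: set_integrable_def)
  fix A :: "'a set" assume "A \<in> sets lborel"
  have "Int_stable (range (\<lambda>(a, b). box a b :: 'a set))"
    by (auto simp: Int_stable_def box_Int_box)
  moreover have "range (\<lambda>(a, b). box a b :: 'a set) \<subseteq> Pow UNIV" by auto
  moreover have "A \<in> sigma_sets UNIV (range (\<lambda>(a, b). box a b))"
    using \<open>A \<in> sets lborel\<close> by (simp add: borel_eq_box)
  ultimately show "set_lebesgue_integral lborel A g = 0"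
  proof (induction rule: sigma_sets_induct_disjoint)
    case (basic A)
    then obtain c d where A: "A = box c d" by auto
    have eq: "indicator A x * g x = indicator (box c d \<inter> box a b) x * g x" for x
      using Q[of x] by (auto simp: A indicator_def)
    have "(LINT x|lborel. indicator A x * g x) = 0"
      unfolding eq unfolding box_Int_box by (rule box) (simp flip: box_Int_box)
    then show ?case by (simp add: set_lebesgue_integral_def)
  next
    case (compl A)
    then have A: "A \<in> sets lborel" by (simp add: borel_eq_box)
    have "(\<lambda>x. indicator (box a b) x * g x) = g"
      using Q by (auto simp: fun_eq_iff split: split_indicator)
    then have "(LINT x|lborel. g x) = 0"
      using box[of a b] by simp
    moreover have "indicator (UNIV - A) x *\<^sub>R g x = g x - indicator A x *\<^sub>R g x" for x
      by (auto simp: indicator_def)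
    ultimately show ?case
      using compl(2) int[OF A] g by (simp add: set_lebesgue_integral_def set_integrable_def)
  next
    case (union F)
    then have F: "F i \<in> sets lborel" for i by (auto simp: borel_eq_box)
    then have "(LINT x:(\<Union>i. F i)|lborel. g x) = (\<Sum>i. (LINT x:(F i)|lborel. g x))"
      using union(1) by (intro lebesgue_integral_countable_add int) (auto simp: disjoint_family_on_def)
    then show ?case using union by simp
  qed (simp add: set_lebesgue_integral_def)
qed

text \<open>The argument over generators lives on Borel sets, whereas \<open>g\<close> is only
  Lebesgue measurable on \<open>\<Omega>\<close>. Hence \<open>g\<close> is extended by zero and
  replaced by a Borel function equal to it almost everywhere.\<close>

lemma fundamental_lemma_calculus_of_variations:
  assumes \<Omega>: "open \<Omega>" and g: "integrable (lebesgue_on \<Omega>) g"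
    and test: "\<And>\<phi>. \<phi> \<in> test_functions \<Omega> \<Longrightarrow> (LINT x|lebesgue_on \<Omega>. \<phi> x * g x) = (0::real)"
  shows "AE x in lebesgue_on \<Omega>. g x = 0"
proof -
  have \<Omega>': "\<Omega> \<inter> space lebesgue \<in> sets lebesgue" using \<Omega> by simp
  let ?G = "\<lambda>x. indicator \<Omega> x * g x"
  have G: "integrable lebesgue ?G"
    using g integrable_restrict_space[OF \<Omega>', of g] by simp
  obtain G' where G': "G' \<in> borel_measurable lborel" and eq: "AE x in lborel. ?G x = G' x"
    using completion_ex_borel_measurable_real[OF borel_measurable_integrable[OF G]] by blast
  have G'_int: "integrable lborel G'"
    using integrable_cong_AE_imp[OF G measurable_completion[OF G'] AE_completion[OF eq]]
    by (simp add: integrable_completion[OF G'])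
  \<comment> \<open>Test functions only reach boxes inside \<open>\<Omega>\<close>, so the claim is
    proved on each box of a countable cover; countably many null sets are then collected.\<close>
  obtain \<D> where \<D>: "countable \<D>" "\<D> \<subseteq> Pow \<Omega>" "\<And>X. X \<in> \<D> \<Longrightarrow> \<exists>a b. X = box a b" "\<Union>\<D> = \<Omega>"
    using open_countable_Union_open_box[OF \<Omega>] by metis
  have "AE x in lborel. \<forall>X\<in>\<D>. x \<in> X \<longrightarrow> G' x = 0"
  proof (rule AE_ball_countable'[OF _ \<D>(1)])
    fix X assume X: "X \<in> \<D>"
    then obtain a b where ab: "X = box a b" using \<D> by blast
    then have sub: "box a b \<subseteq> \<Omega>" using \<D> X by blast
    have "AE x in lborel. indicator (box a b) x * G' x = 0"
    proof (rule AE_eq_0_of_box_integrals)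
      show "integrable lborel (\<lambda>x. indicator (box a b) x * G' x)"
        using integrable_mult_indicator[OF _ G'_int, of "box a b"] by simp
      fix c d :: 'a assume cd: "box c d \<subseteq> box a b"
      have "(LINT x|lborel. indicator (box c d) x * (indicator (box a b) x * G' x)) =
          (LINT x|lborel. indicator (box c d) x * G' x)"
        using cd by (intro Bochner_Integration.integral_cong) (auto simp: indicator_def)
      also have "\<dots> = (LINT x|lebesgue. indicator (box c d) x * G' x)"
        using G' by (intro integral_completion[symmetric]) auto
      also have "\<dots> = (LINT x|lebesgue. indicator (box c d) x * ?G x)"
        using AE_completion[OF eq] borel_measurable_integrable[OF G] measurable_completion[OF G']
        by (intro integral_cong_AE) (auto intro!: borel_measurable_times borel_measurable_indicator)
      also have "\<dots> = (LINT x|lebesgue. indicator \<Omega> x *\<^sub>R (indicator (box c d) x * g x))"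
        by (simp add: mult_ac)
      also have "\<dots> = (LINT x|lebesgue_on \<Omega>. indicator (box c d) x * g x)"
        by (rule integral_restrict_space[OF \<Omega>', symmetric])
      also have "\<dots> = 0"
        using cd sub by (intro integral_over_box_eq_0[OF g test]) auto
      finally show "(LINT x|lborel. indicator (box c d) x * (indicator (box a b) x * G' x)) = 0" .
    qed simp
    then show "AE x in lborel. x \<in> X \<longrightarrow> G' x = 0"
      by eventually_elim (auto simp: ab)
  qed
  then have "AE x in lborel. x \<in> \<Omega> \<longrightarrow> g x = 0"
    using eq by eventually_elim (use \<D>(4) in \<open>auto simp: indicator_def\<close>)
  then show ?thesis
    by (simp add: AE_restrict_space_iff[OF \<Omega>'] AE_completion)
qed

section \<open>Weak derivatives\<close>

locale bounded_open =
  fixes \<Omega> :: "'a::euclidean_space set"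
  assumes open_domain: "open \<Omega>" and bounded_domain: "bounded \<Omega>"
begin

lemma domain_measurable: "\<Omega> \<in> sets lebesgue"
  using open_domain by simp

lemmas test_L2 = test_function_L2[OF domain_measurable]

lemma L2_integrable:
  assumes "(g :: 'a \<Rightarrow> real) \<in> L2 \<Omega>"
  shows "integrable (lebesgue_on \<Omega>) g"
proof -
  interpret finite_measure "lebesgue_on \<Omega>"
    using finite_measure_lebesgue_on[OF lmeasurable_open[OF bounded_domain open_domain]] .
  show ?thesis
    using L2_integrable_norm_sq[OF assms]
    by (intro square_integrable_imp_integrable[OF L2_measurable[OF assms]]) simp
qed

lemma AE_eq_of_test_functions:
  assumes "(g :: 'a \<Rightarrow> real) \<in> L2 \<Omega>" "g' \<in> L2 \<Omega>"
    and "\<And>\<phi>. \<phi> \<in> test_functions \<Omega> \<Longrightarrow> L2_inner \<Omega> \<phi> g = L2_inner \<Omega> \<phi> g'"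
  shows "AE x in lebesgue_on \<Omega>. g x = g' x"
proof -
  have "AE x in lebesgue_on \<Omega>. g x - g' x = 0"
  proof (rule fundamental_lemma_calculus_of_variations[OF open_domain L2_integrable[OF L2_diff[OF assms(1,2)]]])
    show "(LINT x|lebesgue_on \<Omega>. \<phi> x * (g x - g' x)) = 0" if "\<phi> \<in> test_functions \<Omega>" for \<phi>
      using assms that L2_inner_diff_right[OF assms(1,2) test_L2(1)[OF that]] by (simp add: L2_inner_def)
  qed
  then show ?thesis by eventually_elim simp
qed

text \<open>Taking coordinates reduces the vector-valued identity to scalar inner products, to which
  the scalar fundamental lemma and the limit lemmas apply.\<close>

lemma has_weak_grad_iff:
  assumes w: "w \<in> L2 \<Omega>"
  shows "has_weak_grad \<Omega> w g \<longleftrightarrow> g \<in> L2 \<Omega> \<and> (\<forall>\<phi>\<in>test_functions \<Omega>. \<forall>b\<in>Basis.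
    L2_inner \<Omega> w (\<lambda>x. classical_grad \<phi> x \<bullet> b) = - L2_inner \<Omega> \<phi> (\<lambda>x. g x \<bullet> b))"
proof -
  have "(LINT x|lebesgue_on \<Omega>. w x *\<^sub>R classical_grad \<phi> x) = - (LINT x|lebesgue_on \<Omega>. \<phi> x *\<^sub>R g x) \<longleftrightarrow>
     (\<forall>b\<in>Basis. L2_inner \<Omega> w (\<lambda>x. classical_grad \<phi> x \<bullet> b) = - L2_inner \<Omega> \<phi> (\<lambda>x. g x \<bullet> b))"
    if "\<phi> \<in> test_functions \<Omega>" "g \<in> L2 \<Omega>" for \<phi>
  proof -
    note [simp] = L2_integrable_scaleR[OF w test_L2(2)[OF that(1)]] L2_integrable_scaleR[OF test_L2(1)[OF that(1)] that(2)]
    show ?thesis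
      by (simp add: euclidean_eq_iff[where 'a='a] inner_minus_left integral_inner_left[symmetric] L2_inner_def)
  qed
  then show ?thesis by (auto simp: has_weak_grad_def)
qed

lemma has_weak_grad_unique:
  assumes w: "w \<in> L2 \<Omega>" and g: "has_weak_grad \<Omega> w g" "has_weak_grad \<Omega> w g'"
  shows "AE x in lebesgue_on \<Omega>. g x = g' x"
proof -
  have L2: "g \<in> L2 \<Omega>" "g' \<in> L2 \<Omega>" using g by (auto simp: has_weak_grad_def)
  have "AE x in lebesgue_on \<Omega>. \<forall>b\<in>Basis. g x \<bullet> b = g' x \<bullet> b"
  proof (rule AE_ball_countable')
    show "AE x in lebesgue_on \<Omega>. g x \<bullet> b = g' x \<bullet> b" if "b \<in> Basis" for b
    proof (rule AE_eq_of_test_functions[OF L2_component[OF L2(1) that] L2_component[OF L2(2) that]])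
      show "L2_inner \<Omega> \<phi> (\<lambda>x. g x \<bullet> b) = L2_inner \<Omega> \<phi> (\<lambda>x. g' x \<bullet> b)" if "\<phi> \<in> test_functions \<Omega>" for \<phi>
        using g \<open>b \<in> Basis\<close> that unfolding has_weak_grad_iff[OF w] by fastforce
    qed
  qed (simp add: countable_finite)
  then show ?thesis by eventually_elim (simp add: euclidean_eq_iff[where 'a='a])
qed

lemma has_weak_div_iff:
  "has_weak_div \<Omega> \<tau> g \<longleftrightarrow> g \<in> L2 \<Omega> \<and>
    (\<forall>\<phi>\<in>test_functions \<Omega>. L2_inner \<Omega> \<tau> (classical_grad \<phi>) = - L2_inner \<Omega> \<phi> g)"
  by (simp add: has_weak_div_def L2_inner_def)

lemma has_weak_div_unique:
  assumes "has_weak_div \<Omega> \<tau> g" "has_weak_div \<Omega> \<tau> g'"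
  shows "AE x in lebesgue_on \<Omega>. g x = g' x"
  using assms by (intro AE_eq_of_test_functions) (auto simp: has_weak_div_iff)

lemma weak_div:
  assumes "\<tau> \<in> Hdiv \<Omega>"
  shows "has_weak_div \<Omega> \<tau> (weak_div \<Omega> \<tau>)" "weak_div \<Omega> \<tau> \<in> L2 \<Omega>"
proof -
  show "has_weak_div \<Omega> \<tau> (weak_div \<Omega> \<tau>)"
    using assms someI_ex[of "has_weak_div \<Omega> \<tau>"] by (simp add: weak_div_def Hdiv_def)
  then show "weak_div \<Omega> \<tau> \<in> L2 \<Omega>" by (simp add: has_weak_div_def)
qed

section \<open>The closure of the test functions and Green's formula\<close>

text \<open>Elements of \<open>H10\<close> together with an arbitrary representative of their weak gradient.\<close>

definition H10_pair :: "('a \<Rightarrow> real) \<Rightarrow> ('a \<Rightarrow> 'a) \<Rightarrow> bool" where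
  "H10_pair w G \<longleftrightarrow> w \<in> L2 \<Omega> \<and> G \<in> L2 \<Omega> \<and> (\<exists>\<phi>. (\<forall>n. \<phi> n \<in> test_functions \<Omega>) \<and>
    (\<lambda>n. L2_norm \<Omega> (\<lambda>x. \<phi> n x - w x)) \<longlonglongrightarrow> 0 \<and>
    (\<lambda>n. L2_norm \<Omega> (\<lambda>x. classical_grad (\<phi> n) x - G x)) \<longlonglongrightarrow> 0)"

lemma H10_pairE:
  assumes "H10_pair w G"
  obtains \<phi> where "\<And>n. \<phi> n \<in> test_functions \<Omega>" "w \<in> L2 \<Omega>" "G \<in> L2 \<Omega>"
    "(\<lambda>n. L2_norm \<Omega> (\<lambda>x. \<phi> n x - w x)) \<longlonglongrightarrow> 0"
    "(\<lambda>n. L2_norm \<Omega> (\<lambda>x. classical_grad (\<phi> n) x - G x)) \<longlonglongrightarrow> 0"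
  using assms by (auto simp: H10_pair_def)

text \<open>Approximating test functions can be integrated by parts against any other test function,
  and both sides are continuous in \<open>L2\<close>. Hence a limit of classical gradients is
  automatically a weak gradient of the limit.\<close>

lemma H10_pair_has_weak_grad:
  assumes "H10_pair w G"
  shows "has_weak_grad \<Omega> w G"
proof -
  obtain \<phi> where \<phi>: "\<And>n. \<phi> n \<in> test_functions \<Omega>" and L2: "w \<in> L2 \<Omega>" "G \<in> L2 \<Omega>"
    and lim: "(\<lambda>n. L2_norm \<Omega> (\<lambda>x. \<phi> n x - w x)) \<longlonglongrightarrow> 0"
    "(\<lambda>n. L2_norm \<Omega> (\<lambda>x. classical_grad (\<phi> n) x - G x)) \<longlonglongrightarrow> 0"
    using assms by (rule H10_pairE) blast
  have "L2_inner \<Omega> w (\<lambda>x. classical_grad \<psi> x \<bullet> b) = - L2_inner \<Omega> \<psi> (\<lambda>x. G x \<bullet> b)"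
    if \<psi>: "\<psi> \<in> test_functions \<Omega>" and b: "b \<in> Basis" for \<psi> b
  proof (rule LIMSEQ_unique)
    show "(\<lambda>n. L2_inner \<Omega> (\<phi> n) (\<lambda>x. classical_grad \<psi> x \<bullet> b)) \<longlonglongrightarrow> L2_inner \<Omega> w (\<lambda>x. classical_grad \<psi> x \<bullet> b)"
      by (rule L2_inner_tendsto_left[OF test_L2(1)[OF \<phi>] L2(1) L2_component[OF test_L2(2)[OF \<psi>] b] lim(1)])
    have "(\<lambda>n. L2_norm \<Omega> (\<lambda>x. classical_grad (\<phi> n) x \<bullet> b - G x \<bullet> b)) \<longlonglongrightarrow> 0"
    proof (rule Lim_null_comparison[OF _ lim(2)], intro always_eventually allI)
      show "norm (L2_norm \<Omega> (\<lambda>x. classical_grad (\<phi> n) x \<bullet> b - G x \<bullet> b))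
          \<le> L2_norm \<Omega> (\<lambda>x. classical_grad (\<phi> n) x - G x)" for n
        using L2_norm_component_le[OF L2_diff[OF test_L2(2)[OF \<phi>[of n]] L2(2)] b]
        by (simp add: inner_diff_left L2_norm_nonneg)
    qed
    from L2_inner_tendsto_left[OF L2_component[OF test_L2(2)[OF \<phi>] b] L2_component[OF L2(2) b] test_L2(1)[OF \<psi>] this]
    have "(\<lambda>n. - L2_inner \<Omega> \<psi> (\<lambda>x. classical_grad (\<phi> n) x \<bullet> b)) \<longlonglongrightarrow> - L2_inner \<Omega> \<psi> (\<lambda>x. G x \<bullet> b)"
      by (intro tendsto_minus) (simp add: L2_inner_commute[of _ \<psi>])
    then show "(\<lambda>n. L2_inner \<Omega> (\<phi> n) (\<lambda>x. classical_grad \<psi> x \<bullet> b)) \<longlonglongrightarrow> - L2_inner \<Omega> \<psi> (\<lambda>x. G x \<bullet> b)"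
      using test_function_integration_by_parts[OF domain_measurable \<phi> \<psi> b] by simp
  qed
  then show ?thesis using L2 by (simp add: has_weak_grad_iff)
qed

lemma weak_grad:
  assumes "w \<in> H10 \<Omega>"
  shows "H10_pair w (weak_grad \<Omega> w)" "weak_grad \<Omega> w \<in> L2 \<Omega>" "w \<in> L2 \<Omega>"
proof -
  have "w \<in> L2 \<Omega>" and ex: "\<exists>g. has_weak_grad \<Omega> w g"
    using assms by (auto simp: H10_def H1_def)
  moreover have "has_weak_grad \<Omega> w (weak_grad \<Omega> w)"
    unfolding weak_grad_def using ex by (rule someI_ex[of "has_weak_grad \<Omega> w"])
  then have "weak_grad \<Omega> w \<in> L2 \<Omega>"
    by (simp add: has_weak_grad_def)
  ultimately show "H10_pair w (weak_grad \<Omega> w)" "weak_grad \<Omega> w \<in> L2 \<Omega>" "w \<in> L2 \<Omega>"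
    using assms by (auto simp: H10_def H10_pair_def)
qed

text \<open>By uniqueness \<open>G\<close> and the chosen gradient differ on a null set, so the
  distances to the approximating gradients stay the same. This is the passage from pairs back to
  \<open>H10\<close>.\<close>

lemma H10_pair_H10:
  assumes "H10_pair w G"
  shows "w \<in> H10 \<Omega>" "AE x in lebesgue_on \<Omega>. weak_grad \<Omega> w x = G x"
proof -
  obtain \<phi> where \<phi>: "\<And>n. \<phi> n \<in> test_functions \<Omega>" and L2: "w \<in> L2 \<Omega>" "G \<in> L2 \<Omega>"
    and lim: "(\<lambda>n. L2_norm \<Omega> (\<lambda>x. \<phi> n x - w x)) \<longlonglongrightarrow> 0"
    "(\<lambda>n. L2_norm \<Omega> (\<lambda>x. classical_grad (\<phi> n) x - G x)) \<longlonglongrightarrow> 0"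
    using assms by (rule H10_pairE) blast
  have G: "has_weak_grad \<Omega> w G" by (rule H10_pair_has_weak_grad[OF assms])
  then have w: "has_weak_grad \<Omega> w (weak_grad \<Omega> w)"
    unfolding weak_grad_def by (rule someI[of "has_weak_grad \<Omega> w"])
  then have wL2: "weak_grad \<Omega> w \<in> L2 \<Omega>" by (simp add: has_weak_grad_def)
  show eq: "AE x in lebesgue_on \<Omega>. weak_grad \<Omega> w x = G x"
    by (rule has_weak_grad_unique[OF L2(1) w G])
  have "L2_norm \<Omega> (\<lambda>x. classical_grad (\<phi> n) x - weak_grad \<Omega> w x) = L2_norm \<Omega> (\<lambda>x. classical_grad (\<phi> n) x - G x)" for n
    using eq by (intro L2_norm_cong_AE L2_diff test_L2 \<phi> wL2 L2) auto
  with lim have "(\<lambda>n. L2_norm \<Omega> (\<lambda>x. classical_grad (\<phi> n) x - weak_grad \<Omega> w x)) \<longlonglongrightarrow> 0" by simp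
  then show "w \<in> H10 \<Omega>"
    using \<phi> lim(1) L2 w unfolding H10_def H1_def by blast
qed

lemma H10_pair_test_function:
  assumes "\<phi> \<in> test_functions \<Omega>"
  shows "H10_pair \<phi> (classical_grad \<phi>)"
  unfolding H10_pair_def using assms test_L2[OF assms]
  by (auto intro!: exI[of _ "\<lambda>_. \<phi>"] simp: L2_norm_def)

lemma H10_pair_add:
  assumes "H10_pair w G" "H10_pair z H"
  shows "H10_pair (\<lambda>x. w x + z x) (\<lambda>x. G x + H x)"
proof -
  obtain \<phi> where \<phi>: "\<And>n. \<phi> n \<in> test_functions \<Omega>" "w \<in> L2 \<Omega>" "G \<in> L2 \<Omega>"
    "(\<lambda>n. L2_norm \<Omega> (\<lambda>x. \<phi> n x - w x)) \<longlonglongrightarrow> 0"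
    "(\<lambda>n. L2_norm \<Omega> (\<lambda>x. classical_grad (\<phi> n) x - G x)) \<longlonglongrightarrow> 0"
    using assms(1) by (rule H10_pairE) blast
  obtain \<psi> where \<psi>: "\<And>n. \<psi> n \<in> test_functions \<Omega>" "z \<in> L2 \<Omega>" "H \<in> L2 \<Omega>"
    "(\<lambda>n. L2_norm \<Omega> (\<lambda>x. \<psi> n x - z x)) \<longlonglongrightarrow> 0"
    "(\<lambda>n. L2_norm \<Omega> (\<lambda>x. classical_grad (\<psi> n) x - H x)) \<longlonglongrightarrow> 0"
    using assms(2) by (rule H10_pairE) blast
  have lim: "(\<lambda>n. L2_norm \<Omega> (\<lambda>x. (f n x + g n x) - (f' x + g' x))) \<longlonglongrightarrow> 0"
    if "(\<lambda>n. L2_norm \<Omega> (\<lambda>x. f n x - f' x)) \<longlonglongrightarrow> 0" "(\<lambda>n. L2_norm \<Omega> (\<lambda>x. g n x - g' x)) \<longlonglongrightarrow> 0"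
      "\<And>n. f n \<in> L2 \<Omega>" "\<And>n. g n \<in> L2 \<Omega>" "f' \<in> L2 \<Omega>" "g' \<in> L2 \<Omega>"
    for f g :: "nat \<Rightarrow> 'a \<Rightarrow> 'b::euclidean_space" and f' g'
  proof (rule Lim_null_comparison)
    show "(\<lambda>n. L2_norm \<Omega> (\<lambda>x. f n x - f' x) + L2_norm \<Omega> (\<lambda>x. g n x - g' x)) \<longlonglongrightarrow> 0"
      using tendsto_add[OF that(1,2)] by simp
    show "\<forall>\<^sub>F n in sequentially. norm (L2_norm \<Omega> (\<lambda>x. (f n x + g n x) - (f' x + g' x)))
        \<le> L2_norm \<Omega> (\<lambda>x. f n x - f' x) + L2_norm \<Omega> (\<lambda>x. g n x - g' x)"
      using L2_norm_triangle[OF L2_diff[OF that(3,5)] L2_diff[OF that(4,6)]]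
      by (intro always_eventually allI) (simp add: L2_norm_nonneg algebra_simps)
  qed
  show ?thesis
    unfolding H10_pair_def
    using lim[OF \<phi>(4) \<psi>(4) test_L2(1)[OF \<phi>(1)] test_L2(1)[OF \<psi>(1)] \<phi>(2) \<psi>(2)]
      lim[OF \<phi>(5) \<psi>(5) test_L2(2)[OF \<phi>(1)] test_L2(2)[OF \<psi>(1)] \<phi>(3) \<psi>(3)]
    by (intro conjI L2_add \<phi> \<psi> exI[of _ "\<lambda>n x. \<phi> n x + \<psi> n x"] allI test_functions_add)
      (simp_all add: classical_grad_add[OF \<phi>(1) \<psi>(1)])
qed

lemma H10_pair_cmult:
  assumes "H10_pair w G"
  shows "H10_pair (\<lambda>x. c * w x) (\<lambda>x. c *\<^sub>R G x)"
proof -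
  obtain \<phi> where \<phi>: "\<And>n. \<phi> n \<in> test_functions \<Omega>" "w \<in> L2 \<Omega>" "G \<in> L2 \<Omega>"
    "(\<lambda>n. L2_norm \<Omega> (\<lambda>x. \<phi> n x - w x)) \<longlonglongrightarrow> 0"
    "(\<lambda>n. L2_norm \<Omega> (\<lambda>x. classical_grad (\<phi> n) x - G x)) \<longlonglongrightarrow> 0"
    using assms by (rule H10_pairE) blast
  have lim: "(\<lambda>n. L2_norm \<Omega> (\<lambda>x. c *\<^sub>R f n x - c *\<^sub>R f' x)) \<longlonglongrightarrow> 0"
    if "(\<lambda>n. L2_norm \<Omega> (\<lambda>x. f n x - f' x)) \<longlonglongrightarrow> 0"
    for f :: "nat \<Rightarrow> 'a \<Rightarrow> 'b::euclidean_space" and f'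
    using tendsto_mult_left[OF that, of "\<bar>c\<bar>"] by (simp add: L2_norm_scaleR flip: scaleR_diff_right)
  show ?thesis
    unfolding H10_pair_def using lim[OF \<phi>(4)] lim[OF \<phi>(5)]
    by (intro conjI L2_scaleR L2_cmult \<phi> exI[of _ "\<lambda>n x. c * \<phi> n x"] allI test_functions_cmult)
      (simp_all add: classical_grad_cmult[OF \<phi>(1)])
qed

text \<open>Both sides are continuous under the approximation of \<open>w\<close> and
  \<open>G\<close> by test functions. It serves for Green's formula as well as for the weak
  formulation satisfied by the limit of a minimising sequence.\<close>

lemma H10_density:
  assumes "H10_pair w G" "k \<in> L2 \<Omega>" "K \<in> L2 \<Omega>"
    and "\<And>\<phi>. \<phi> \<in> test_functions \<Omega> \<Longrightarrow> L2_inner \<Omega> K (classical_grad \<phi>) = L2_inner \<Omega> k \<phi>"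
  shows "L2_inner \<Omega> K G = L2_inner \<Omega> k w"
proof -
  obtain \<phi> where \<phi>: "\<And>n. \<phi> n \<in> test_functions \<Omega>" and L2: "w \<in> L2 \<Omega>" "G \<in> L2 \<Omega>"
    and lim: "(\<lambda>n. L2_norm \<Omega> (\<lambda>x. \<phi> n x - w x)) \<longlonglongrightarrow> 0"
    "(\<lambda>n. L2_norm \<Omega> (\<lambda>x. classical_grad (\<phi> n) x - G x)) \<longlonglongrightarrow> 0"
    using assms(1) by (rule H10_pairE) blast
  have "(\<lambda>n. L2_inner \<Omega> K (classical_grad (\<phi> n))) \<longlonglongrightarrow> L2_inner \<Omega> K G"
    using L2_inner_tendsto_left[OF test_L2(2)[OF \<phi>] L2(2) assms(3) lim(2)] by (simp add: L2_inner_commute[of _ _ K])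
  moreover have "(\<lambda>n. L2_inner \<Omega> k (\<phi> n)) \<longlonglongrightarrow> L2_inner \<Omega> k w"
    using L2_inner_tendsto_left[OF test_L2(1)[OF \<phi>] L2(1) assms(2) lim(1)] by (simp add: L2_inner_commute[of _ _ k])
  ultimately show ?thesis
    using assms(4)[OF \<phi>] by (simp add: LIMSEQ_unique)
qed

lemma Green_formula:
  assumes "\<zeta> \<in> H10 \<Omega>" "\<tau> \<in> Hdiv \<Omega>"
  shows "L2_inner \<Omega> \<tau> (weak_grad \<Omega> \<zeta>) = - L2_inner \<Omega> (weak_div \<Omega> \<tau>) \<zeta>"
proof -
  have "L2_inner \<Omega> \<tau> (weak_grad \<Omega> \<zeta>) = L2_inner \<Omega> (\<lambda>x. (-1) *\<^sub>R weak_div \<Omega> \<tau> x) \<zeta>"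
  proof (rule H10_density[OF weak_grad(1)[OF assms(1)]])
    show "L2_inner \<Omega> \<tau> (classical_grad \<phi>) = L2_inner \<Omega> (\<lambda>x. (-1) *\<^sub>R weak_div \<Omega> \<tau> x) \<phi>"
      if "\<phi> \<in> test_functions \<Omega>" for \<phi>
      using weak_div(1)[OF assms(2)] that L2_inner_commute[of \<Omega> \<phi>]
      unfolding has_weak_div_iff L2_inner_scaleR_left by simp
    show "\<tau> \<in> L2 \<Omega>" using assms(2) by (simp add: Hdiv_def)
  qed (rule L2_scaleR[OF weak_div(2)[OF assms(2)]])
  then show ?thesis unfolding L2_inner_scaleR_left by simp
qed

end

section \<open>The elliptic problem\<close>

locale elliptic_problem = bounded_open \<Omega> for \<Omega> :: "'a::euclidean_space set" +
  fixes \<nu> :: "'a \<Rightarrow> real" and nu_lo nu_hi C\<^sub>F :: real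
  assumes nu_measurable: "\<nu> \<in> borel_measurable (lebesgue_on \<Omega>)"
    and nu_lo_pos: "0 < nu_lo"
    and nu_bounds: "\<And>x. x \<in> \<Omega> \<Longrightarrow> nu_lo \<le> \<nu> x \<and> \<nu> x \<le> nu_hi"
    and C\<^sub>F_pos: "0 < C\<^sub>F"
    and Friedrichs: "\<And>w. w \<in> H10 \<Omega> \<Longrightarrow> L2_norm \<Omega> w \<le> C\<^sub>F * L2_norm \<Omega> (weak_grad \<Omega> w)"
begin

definition energy :: "('a \<Rightarrow> 'a) \<Rightarrow> ('a \<Rightarrow> 'a) \<Rightarrow> real" where
  "energy G H = L2_inner \<Omega> (\<lambda>x. \<nu> x *\<^sub>R G x) H"

lemma nu_L2: "G \<in> L2 \<Omega> \<Longrightarrow> (\<lambda>x. \<nu> x *\<^sub>R G x) \<in> L2 \<Omega>"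
  using nu_bounds nu_lo_pos by (intro L2_bounded_scaleR[OF _ nu_measurable, of _ nu_hi]) fastforce+

lemma energy_commute: "energy G H = energy H G"
  by (simp add: energy_def L2_inner_def inner_commute)

lemma energy_add_left:
  "F \<in> L2 \<Omega> \<Longrightarrow> G \<in> L2 \<Omega> \<Longrightarrow> H \<in> L2 \<Omega> \<Longrightarrow> energy (\<lambda>x. F x + G x) H = energy F H + energy G H"
  by (simp add: energy_def scaleR_add_right L2_inner_add_left nu_L2)

lemma energy_scaleR_left: "energy (\<lambda>x. c *\<^sub>R G x) H = c * energy G H"
  using L2_inner_scaleR_left[of \<Omega> c "\<lambda>x. \<nu> x *\<^sub>R G x" H] by (simp add: energy_def mult.commute)

lemma energy_add_right:
  "F \<in> L2 \<Omega> \<Longrightarrow> G \<in> L2 \<Omega> \<Longrightarrow> H \<in> L2 \<Omega> \<Longrightarrow> energy H (\<lambda>x. F x + G x) = energy H F + energy H G"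
  unfolding energy_commute[of H] by (rule energy_add_left)

lemma energy_scaleR_right: "energy H (\<lambda>x. c *\<^sub>R G x) = c * energy H G"
  unfolding energy_commute[of H] by (rule energy_scaleR_left)

lemma energy_coercive:
  assumes "G \<in> L2 \<Omega>"
  shows "nu_lo * (L2_norm \<Omega> G)\<^sup>2 \<le> energy G G"
proof -
  have "nu_lo * (L2_norm \<Omega> G)\<^sup>2 = (LINT x|lebesgue_on \<Omega>. nu_lo * (norm (G x))\<^sup>2)"
    by (simp add: L2_norm_def)
  also have "\<dots> \<le> (LINT x|lebesgue_on \<Omega>. (\<nu> x *\<^sub>R G x) \<bullet> G x)"
    using nu_bounds assms
    by (intro integral_mono L2_integrable_inner nu_L2 integrable_mult_right L2_integrable_norm_sq)
      (auto simp: power2_norm_eq_inner intro!: mult_right_mono)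
  finally show ?thesis by (simp add: energy_def L2_inner_def)
qed

lemma energy_cong_AE:
  assumes "G \<in> L2 \<Omega>" "G' \<in> L2 \<Omega>" "H \<in> L2 \<Omega>" "H' \<in> L2 \<Omega>"
    and "AE x in lebesgue_on \<Omega>. G x = G' x" "AE x in lebesgue_on \<Omega>. H x = H' x"
  shows "energy G H = energy G' H'"
  unfolding energy_def using assms by (intro L2_inner_cong_AE nu_L2) auto

section \<open>Existence of weak solutions by minimisation\<close>

lemma is_weak_solution_iff:
  "is_weak_solution \<Omega> \<nu> g z \<longleftrightarrow> z \<in> H10 \<Omega> \<and>
     (\<forall>w\<in>H10 \<Omega>. energy (weak_grad \<Omega> z) (weak_grad \<Omega> w) = L2_inner \<Omega> g w)"
  by (simp add: is_weak_solution_def energy_def L2_inner_def)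

lemma Friedrichs_test_function:
  assumes "\<phi> \<in> test_functions \<Omega>"
  shows "L2_norm \<Omega> \<phi> \<le> C\<^sub>F * L2_norm \<Omega> (classical_grad \<phi>)"
proof -
  note P = H10_pair_H10[OF H10_pair_test_function[OF assms]]
  have "L2_norm \<Omega> (weak_grad \<Omega> \<phi>) = L2_norm \<Omega> (classical_grad \<phi>)"
    by (rule L2_norm_cong_AE[OF weak_grad(2)[OF P(1)] test_L2(2)[OF assms] P(2)])
  then show ?thesis using Friedrichs[OF P(1)] by simp
qed

text \<open>Weak solutions are the limits of its minimising sequences.\<close>

definition Dirichlet :: "('a \<Rightarrow> real) \<Rightarrow> ('a \<Rightarrow> real) \<Rightarrow> real" where
  "Dirichlet g \<phi> = energy (classical_grad \<phi>) (classical_grad \<phi>) / 2 - L2_inner \<Omega> g \<phi>"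

text \<open>With t the norm of the gradient and c = \<open>L2_norm \<Omega> g * C\<^sub>F\<close>,
  coercivity and Friedrichs' inequality bound the functional below by \<open>nu_lo\<close> * t^2 / 2
  - c * t. Completing the square gives the constant.\<close>

lemma Dirichlet_bounded_below:
  assumes g: "g \<in> L2 \<Omega>" and \<phi>: "\<phi> \<in> test_functions \<Omega>"
  shows "- ((L2_norm \<Omega> g * C\<^sub>F)\<^sup>2 / (2 * nu_lo)) \<le> Dirichlet g \<phi>"
proof -
  let ?c = "L2_norm \<Omega> g * C\<^sub>F" and ?t = "L2_norm \<Omega> (classical_grad \<phi>)"
  have "L2_inner \<Omega> g \<phi> \<le> L2_norm \<Omega> g * L2_norm \<Omega> \<phi>"
    using L2_Cauchy_Schwarz[OF g test_L2(1)[OF \<phi>]] by simp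
  also have "\<dots> \<le> ?c * ?t"
    using mult_left_mono[OF Friedrichs_test_function[OF \<phi>] L2_norm_nonneg[of \<Omega> g]] by (simp add: mult.assoc)
  finally have "nu_lo * ?t\<^sup>2 / 2 - ?c * ?t \<le> Dirichlet g \<phi>"
    using energy_coercive[OF test_L2(2)[OF \<phi>]] by (simp add: Dirichlet_def)
  moreover have "nu_lo * ?t\<^sup>2 / 2 - ?c * ?t + ?c\<^sup>2 / (2 * nu_lo) = (nu_lo * ?t - ?c)\<^sup>2 / (2 * nu_lo)"
    using nu_lo_pos by (simp add: field_simps power2_eq_square)
  moreover have "0 \<le> (nu_lo * ?t - ?c)\<^sup>2 / (2 * nu_lo)" using nu_lo_pos by simp
  ultimately show ?thesis by linarith
qed

lemma Dirichlet_perturb: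
  assumes g: "g \<in> L2 \<Omega>" and \<phi>: "\<phi> \<in> test_functions \<Omega>" and \<psi>: "\<psi> \<in> test_functions \<Omega>"
  shows "Dirichlet g (\<lambda>x. \<phi> x + t * \<psi> x) = Dirichlet g \<phi>
    + t * (energy (classical_grad \<phi>) (classical_grad \<psi>) - L2_inner \<Omega> g \<psi>)
    + t\<^sup>2 * (energy (classical_grad \<psi>) (classical_grad \<psi>) / 2)"
proof -
  have grad: "classical_grad (\<lambda>x. \<phi> x + t * \<psi> x) = (\<lambda>x. classical_grad \<phi> x + t *\<^sub>R classical_grad \<psi> x)"
    using classical_grad_add[OF \<phi> test_functions_cmult[OF \<psi>]] classical_grad_cmult[OF \<psi>] by auto
  have "L2_inner \<Omega> g (\<lambda>x. \<phi> x + t *\<^sub>R \<psi> x) = L2_inner \<Omega> g \<phi> + t * L2_inner \<Omega> g \<psi>"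
    using L2_inner_scaleR_right[of \<Omega> g t \<psi>] g test_L2(1)[OF \<phi>] L2_scaleR[OF test_L2(1)[OF \<psi>], of t]
    by (subst L2_inner_add_right) auto
  moreover have "energy (\<lambda>x. classical_grad \<phi> x + t *\<^sub>R classical_grad \<psi> x) (\<lambda>x. classical_grad \<phi> x + t *\<^sub>R classical_grad \<psi> x)
    = energy (classical_grad \<phi>) (classical_grad \<phi>) + 2 * t * energy (classical_grad \<phi>) (classical_grad \<psi>)
      + t\<^sup>2 * energy (classical_grad \<psi>) (classical_grad \<psi>)"
    using test_L2(2)[OF \<phi>] test_L2(2)[OF \<psi>] L2_scaleR[OF test_L2(2)[OF \<psi>], of t]
    by (simp add: energy_add_left energy_add_right energy_scaleR_left energy_scaleR_right L2_add
        energy_commute[of "classical_grad \<psi>" "classical_grad \<phi>"] power2_eq_square algebra_simps)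
  ultimately show ?thesis
    by (simp add: Dirichlet_def grad field_simps)
qed

text \<open>No direction can lower the functional by more than the gap to the infimum, here less
  than 1/(n+1). Nonnegativity of the resulting quadratic in the step length bounds the residual by
  its discriminant.\<close>

lemma minimizing_sequence:
  assumes g: "g \<in> L2 \<Omega>"
  obtains \<phi> where "\<And>n. \<phi> n \<in> test_functions \<Omega>"
    "\<And>n \<psi>. \<psi> \<in> test_functions \<Omega> \<Longrightarrow>
      (energy (classical_grad (\<phi> n)) (classical_grad \<psi>) - L2_inner \<Omega> g \<psi>)\<^sup>2
        \<le> 2 * inverse (real (Suc n)) * energy (classical_grad \<psi>) (classical_grad \<psi>)"
proof -
  let ?I = "INF \<phi>\<in>test_functions \<Omega>. Dirichlet g \<phi>"
  have bdd: "bdd_below (Dirichlet g ` test_functions \<Omega>)"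
    using Dirichlet_bounded_below[OF g] by (auto intro!: bdd_belowI2)
  have "\<exists>\<phi>\<in>test_functions \<Omega>. Dirichlet g \<phi> < ?I + inverse (real (Suc n))" for n
    using cINF_less_iff[of "test_functions \<Omega>" "Dirichlet g" "?I + inverse (real (Suc n))"] bdd test_functions_0
    by auto
  then obtain \<phi> where \<phi>: "\<And>n. \<phi> n \<in> test_functions \<Omega>" "\<And>n. Dirichlet g (\<phi> n) < ?I + inverse (real (Suc n))"
    by metis
  show thesis
  proof (rule that[OF \<phi>(1)])
    fix n \<psi> assume \<psi>: "\<psi> \<in> test_functions \<Omega>"
    let ?R = "energy (classical_grad (\<phi> n)) (classical_grad \<psi>) - L2_inner \<Omega> g \<psi>"
    let ?e = "energy (classical_grad \<psi>) (classical_grad \<psi>)"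
    have "0 \<le> inverse (real (Suc n)) - 2 * t * (- ?R / 2) + t\<^sup>2 * (?e / 2)" for t
    proof -
      have "?I \<le> Dirichlet g (\<lambda>x. \<phi> n x + t * \<psi> x)"
        by (intro cINF_lower[OF bdd] test_functions_add test_functions_cmult \<phi> \<psi>)
      moreover have "2 * t * (- r / 2) = - (t * r)" for r :: real by simp
      ultimately show ?thesis
        using \<phi>(2)[of n] Dirichlet_perturb[OF g \<phi>(1)[of n] \<psi>, of t] by linarith
    qed
    moreover have "0 \<le> ?e"
      using energy_coercive[OF test_L2(2)[OF \<psi>]] nu_lo_pos by (meson mult_nonneg_nonneg less_imp_le order_trans zero_le_power2)
    ultimately have "(- ?R / 2)\<^sup>2 \<le> inverse (real (Suc n)) * (?e / 2)"
      by (intro quadratic_nonneg_imp_discriminant) auto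
    moreover have "r\<^sup>2 \<le> 2 * s * e" if "(- r / 2)\<^sup>2 \<le> s * (e / 2)" for r s e :: real
      using that by (simp add: power_divide)
    ultimately show "?R\<^sup>2 \<le> 2 * inverse (real (Suc n)) * ?e" by blast
  qed
qed

text \<open>Tested with the difference of two members, the load term cancels and the energy e of
  that difference equals the difference of two residuals. The residual bounds give e^2 \<le> 4 *
  (1/(m+1) + 1/(n+1)) * e, and one factor e cancels.\<close>

lemma minimizing_sequence_Cauchy:
  assumes \<phi>: "\<And>n. \<phi> n \<in> test_functions \<Omega>"
    and R: "\<And>n \<psi>. \<psi> \<in> test_functions \<Omega> \<Longrightarrow>
      (energy (classical_grad (\<phi> n)) (classical_grad \<psi>) - L2_inner \<Omega> g \<psi>)\<^sup>2
        \<le> 2 * inverse (real (Suc n)) * energy (classical_grad \<psi>) (classical_grad \<psi>)"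
  shows "nu_lo * (L2_norm \<Omega> (\<lambda>x. classical_grad (\<phi> m) x - classical_grad (\<phi> n) x))\<^sup>2
    \<le> 4 * (inverse (real (Suc m)) + inverse (real (Suc n)))"
proof -
  let ?\<psi> = "\<lambda>x. \<phi> m x - \<phi> n x"
  let ?s = "\<lambda>n. inverse (real (Suc n))"
  let ?R = "\<lambda>n. energy (classical_grad (\<phi> n)) (classical_grad ?\<psi>) - L2_inner \<Omega> g ?\<psi>"
  let ?e = "energy (classical_grad ?\<psi>) (classical_grad ?\<psi>)"
  note \<psi> = classical_grad_diff[OF \<phi>[of m] \<phi>[of n]]
  have "classical_grad ?\<psi> = (\<lambda>x. classical_grad (\<phi> m) x + (-1) *\<^sub>R classical_grad (\<phi> n) x)"
    using \<psi>(2) by auto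
  then have "?e = energy (\<lambda>x. classical_grad (\<phi> m) x + (-1) *\<^sub>R classical_grad (\<phi> n) x) (classical_grad ?\<psi>)"
    by (rule arg_cong)
  also have "\<dots> = ?R m - ?R n"
    by (subst energy_add_left; (intro L2_scaleR test_L2 \<phi> \<psi>)?) (simp only: energy_scaleR_left)
  finally have e: "?e = ?R m - ?R n" .
  have "(a - b)\<^sup>2 \<le> 2 * a\<^sup>2 + 2 * b\<^sup>2" for a b :: real
    using sum_squares_bound[of a "- b"] by (simp add: power2_diff)
  then have "(?R m - ?R n)\<^sup>2 \<le> 2 * (?R m)\<^sup>2 + 2 * (?R n)\<^sup>2" .
  also have "\<dots> \<le> 2 * (2 * ?s m * ?e) + 2 * (2 * ?s n * ?e)"
    by (intro add_mono mult_left_mono R[OF \<psi>(1)]) auto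
  finally have "?e * ?e \<le> (4 * (?s m + ?s n)) * ?e"
    unfolding e[symmetric] power2_eq_square by (simp add: algebra_simps)
  moreover have s: "0 < 4 * (?s m + ?s n)" by (simp add: add_pos_pos del: distrib_left_numeral)
  ultimately have "?e \<le> 4 * (?s m + ?s n)"
    by (cases "?e > 0") (auto simp: mult_le_cancel_right)
  moreover have "nu_lo * (L2_norm \<Omega> (classical_grad ?\<psi>))\<^sup>2 \<le> ?e"
    by (rule energy_coercive[OF test_L2(2)[OF \<psi>(1)]])
  moreover have "classical_grad ?\<psi> = (\<lambda>x. classical_grad (\<phi> m) x - classical_grad (\<phi> n) x)"
    using \<psi>(2) by auto
  ultimately show ?thesis by simp
qed

lemma weak_solution_exists:
  assumes g: "g \<in> L2 \<Omega>"
  shows "\<exists>z. is_weak_solution \<Omega> \<nu> g z"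
proof -
  obtain \<phi> where \<phi>: "\<And>n. \<phi> n \<in> test_functions \<Omega>"
    and R: "\<And>n \<psi>. \<psi> \<in> test_functions \<Omega> \<Longrightarrow>
      (energy (classical_grad (\<phi> n)) (classical_grad \<psi>) - L2_inner \<Omega> g \<psi>)\<^sup>2
        \<le> 2 * inverse (real (Suc n)) * energy (classical_grad \<psi>) (classical_grad \<psi>)"
    using minimizing_sequence[OF g] by metis
  have grad_Cauchy: "\<exists>N. \<forall>m\<ge>N. \<forall>n\<ge>N. L2_norm \<Omega> (\<lambda>x. classical_grad (\<phi> m) x - classical_grad (\<phi> n) x) \<le> e"
    if "e > 0" for e
  proof -
    \<comment> \<open>The eighth matches the Cauchy estimate: four times the sum of two such terms
      is \<open>nu_lo * e\<^sup>2\<close>.\<close>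
    have "0 < nu_lo * e\<^sup>2 / 8" using nu_lo_pos that by simp
    then obtain N where N: "inverse (real (Suc N)) < nu_lo * e\<^sup>2 / 8"
      using reals_Archimedean by blast
    have s: "inverse (real (Suc n)) \<le> nu_lo * e\<^sup>2 / 8" if "n \<ge> N" for n
      using N that by (intro order.trans[OF le_imp_inverse_le less_imp_le[OF N]]) auto
    have "L2_norm \<Omega> (\<lambda>x. classical_grad (\<phi> m) x - classical_grad (\<phi> n) x) \<le> e" if "m \<ge> N" "n \<ge> N" for m n
    proof (rule power2_le_imp_le)
      have "nu_lo * (L2_norm \<Omega> (\<lambda>x. classical_grad (\<phi> m) x - classical_grad (\<phi> n) x))\<^sup>2 \<le> nu_lo * e\<^sup>2"
        using minimizing_sequence_Cauchy[OF \<phi> R, of m n] s[OF that(1)] s[OF that(2)] by simp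
      then show "(L2_norm \<Omega> (\<lambda>x. classical_grad (\<phi> m) x - classical_grad (\<phi> n) x))\<^sup>2 \<le> e\<^sup>2"
        using nu_lo_pos by simp
    qed (use \<open>e > 0\<close> in simp)
    then show ?thesis by blast
  qed
  obtain G where G: "G \<in> L2 \<Omega>" "(\<lambda>n. L2_norm \<Omega> (\<lambda>x. classical_grad (\<phi> n) x - G x)) \<longlonglongrightarrow> 0"
    using L2_complete[OF test_L2(2)[OF \<phi>] grad_Cauchy] by blast
  \<comment> \<open>Friedrichs' inequality on differences of test functions makes the functions
    Cauchy once the gradients are.\<close>
  have Cauchy: "\<exists>N. \<forall>m\<ge>N. \<forall>n\<ge>N. L2_norm \<Omega> (\<lambda>x. \<phi> m x - \<phi> n x) \<le> e" if "e > 0" for e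
  proof -
    have "0 < e / C\<^sub>F" using that C\<^sub>F_pos by simp
    from grad_Cauchy[OF this] obtain N where N: "\<forall>m\<ge>N. \<forall>n\<ge>N.
        L2_norm \<Omega> (\<lambda>x. classical_grad (\<phi> m) x - classical_grad (\<phi> n) x) \<le> e / C\<^sub>F"
      by blast
    have "L2_norm \<Omega> (\<lambda>x. \<phi> m x - \<phi> n x) \<le> e" if "m \<ge> N" "n \<ge> N" for m n
    proof -
      have "L2_norm \<Omega> (\<lambda>x. \<phi> m x - \<phi> n x) \<le> C\<^sub>F * L2_norm \<Omega> (\<lambda>x. classical_grad (\<phi> m) x - classical_grad (\<phi> n) x)"
        using Friedrichs_test_function[OF classical_grad_diff(1)[OF \<phi> \<phi>], of m n]
        unfolding classical_grad_diff(2)[OF \<phi> \<phi>, of m n, abs_def] .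
      also have "\<dots> \<le> C\<^sub>F * (e / C\<^sub>F)"
        by (intro mult_left_mono N[rule_format] that) (use C\<^sub>F_pos in simp)
      finally show ?thesis using C\<^sub>F_pos by simp
    qed
    then show ?thesis by blast
  qed
  obtain z where z: "z \<in> L2 \<Omega>" "(\<lambda>n. L2_norm \<Omega> (\<lambda>x. \<phi> n x - z x)) \<longlonglongrightarrow> 0"
    using L2_complete[of \<phi>, OF test_L2(1)[OF \<phi>] Cauchy] by blast
  have pair: "H10_pair z G"
    unfolding H10_pair_def using z G \<phi> by blast
  note zH = H10_pair_H10[OF pair]
  \<comment> \<open>For a fixed direction the residual bound tends to zero, while the residuals
    themselves converge to the residual of \<open>G\<close>.\<close>
  have test: "energy G (classical_grad \<psi>) = L2_inner \<Omega> g \<psi>" if \<psi>: "\<psi> \<in> test_functions \<Omega>" for \<psi>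
  proof -
    let ?e = "energy (classical_grad \<psi>) (classical_grad \<psi>)"
    let ?R = "\<lambda>n. energy (classical_grad (\<phi> n)) (classical_grad \<psi>) - L2_inner \<Omega> g \<psi>"
    have "(\<lambda>n. 2 * inverse (real (Suc n)) * ?e) \<longlonglongrightarrow> 2 * 0 * ?e"
      by (intro tendsto_intros LIMSEQ_inverse_real_of_nat)
    then have "(\<lambda>n. (?R n)\<^sup>2) \<longlonglongrightarrow> 0"
      by (intro Lim_null_comparison[of "\<lambda>n. (?R n)\<^sup>2"]) (use R[OF \<psi>] in simp_all)
    then have "?R \<longlonglongrightarrow> 0" by (simp only: power_tendsto_0_iff zero_less_numeral)
    moreover have "?R \<longlonglongrightarrow> energy G (classical_grad \<psi>) - L2_inner \<Omega> g \<psi>"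
      unfolding energy_commute[of _ "classical_grad \<psi>"] unfolding energy_def L2_inner_commute[of \<Omega> "\<lambda>x. \<nu> x *\<^sub>R classical_grad \<psi> x"]
      by (intro tendsto_intros L2_inner_tendsto_left[OF test_L2(2)[OF \<phi>] G(1) nu_L2[OF test_L2(2)[OF \<psi>]] G(2)])
    ultimately show ?thesis using LIMSEQ_unique by fastforce
  qed
  have "energy (weak_grad \<Omega> z) (weak_grad \<Omega> w) = L2_inner \<Omega> g w" if "w \<in> H10 \<Omega>" for w
  proof -
    have "energy (weak_grad \<Omega> z) (weak_grad \<Omega> w) = energy G (weak_grad \<Omega> w)"
      using zH by (intro energy_cong_AE weak_grad that G) auto
    also have "\<dots> = L2_inner \<Omega> g w"
      unfolding energy_def
      by (rule H10_density[OF weak_grad(1)[OF that] g nu_L2[OF G(1)]]) (use test in \<open>simp add: energy_def\<close>)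
    finally show ?thesis .
  qed
  then show ?thesis using zH by (auto simp: is_weak_solution_iff)
qed

section \<open>Linearity, uniqueness and fluxes of weak solutions\<close>

lemma weak_solution: "g \<in> L2 \<Omega> \<Longrightarrow> is_weak_solution \<Omega> \<nu> g (weak_solution \<Omega> \<nu> g)"
  unfolding weak_solution_def by (rule someI_ex[of "is_weak_solution \<Omega> \<nu> g", OF weak_solution_exists])

text \<open>With \<open>t = -1\<close> this gives uniqueness; with a step length \<open>t\<close> it
  describes how the state responds to a perturbed control.\<close>

lemma is_weak_solution_lincomb:
  assumes "is_weak_solution \<Omega> \<nu> g z" "is_weak_solution \<Omega> \<nu> h w" "g \<in> L2 \<Omega>" "h \<in> L2 \<Omega>"
  shows "is_weak_solution \<Omega> \<nu> (\<lambda>x. g x + t * h x) (\<lambda>x. z x + t * w x)"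
proof -
  have zw: "z \<in> H10 \<Omega>" "w \<in> H10 \<Omega>" using assms by (auto simp: is_weak_solution_def)
  note P = H10_pair_H10[OF H10_pair_add[OF weak_grad(1)[OF zw(1)] H10_pair_cmult[OF weak_grad(1)[OF zw(2)], of t]]]
  have "energy (weak_grad \<Omega> (\<lambda>x. z x + t * w x)) (weak_grad \<Omega> k) = L2_inner \<Omega> (\<lambda>x. g x + t *\<^sub>R h x) k"
    if k: "k \<in> H10 \<Omega>" for k
  proof -
    have "energy (weak_grad \<Omega> (\<lambda>x. z x + t * w x)) (weak_grad \<Omega> k)
        = energy (\<lambda>x. weak_grad \<Omega> z x + t *\<^sub>R weak_grad \<Omega> w x) (weak_grad \<Omega> k)"
      using P by (intro energy_cong_AE L2_add L2_scaleR weak_grad zw k) auto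
    also have "\<dots> = energy (weak_grad \<Omega> z) (weak_grad \<Omega> k) + t * energy (weak_grad \<Omega> w) (weak_grad \<Omega> k)"
      by (subst energy_add_left) (simp_all only: energy_scaleR_left weak_grad zw k L2_scaleR)
    also have "\<dots> = L2_inner \<Omega> g k + t * L2_inner \<Omega> h k"
      using assms k by (simp add: is_weak_solution_iff)
    also have "\<dots> = L2_inner \<Omega> (\<lambda>x. g x + t *\<^sub>R h x) k"
      by (subst L2_inner_add_left) (simp_all only: L2_inner_scaleR_left assms L2_scaleR weak_grad(3)[OF k])
    finally show ?thesis .
  qed
  then show ?thesis using P(1) by (simp add: is_weak_solution_iff)
qed

lemma is_weak_solution_unique:
  assumes "is_weak_solution \<Omega> \<nu> g z" "is_weak_solution \<Omega> \<nu> g w" "g \<in> L2 \<Omega>"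
  shows "AE x in lebesgue_on \<Omega>. z x = w x"
proof -
  let ?d = "\<lambda>x. z x + (-1) * w x"
  have d: "is_weak_solution \<Omega> \<nu> (\<lambda>x. g x + (-1) * g x) ?d"
    by (rule is_weak_solution_lincomb) fact+
  then have dH: "?d \<in> H10 \<Omega>" by (simp add: is_weak_solution_def)
  then have "energy (weak_grad \<Omega> ?d) (weak_grad \<Omega> ?d) = 0"
    using d by (simp add: is_weak_solution_iff L2_inner_def)
  then have "nu_lo * (L2_norm \<Omega> (weak_grad \<Omega> ?d))\<^sup>2 \<le> 0"
    using energy_coercive[OF weak_grad(2)[OF dH]] by simp
  then have "L2_norm \<Omega> (weak_grad \<Omega> ?d) = 0"
    using nu_lo_pos by (simp add: mult_le_0_iff)
  then have "L2_norm \<Omega> ?d = 0"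
    using Friedrichs[OF dH] L2_norm_nonneg[of \<Omega> ?d] by simp
  from L2_norm_eq_0D[OF weak_grad(3)[OF dH] this] show ?thesis
    by eventually_elim simp
qed

text \<open>On test functions, whose chosen weak gradient is almost everywhere the classical one,
  the weak formulation says precisely that the flux has weak divergence \<open>- g\<close>. The
  exact fluxes are thus admissible and leave no equilibrium residual.\<close>

lemma flux_of_weak_solution:
  assumes z: "is_weak_solution \<Omega> \<nu> g z" and g: "g \<in> L2 \<Omega>"
  shows "(\<lambda>x. \<nu> x *\<^sub>R weak_grad \<Omega> z x) \<in> Hdiv \<Omega>"
    and "AE x in lebesgue_on \<Omega>. g x + weak_div \<Omega> (\<lambda>x. \<nu> x *\<^sub>R weak_grad \<Omega> z x) x = 0"
proof -
  let ?\<tau> = "\<lambda>x. \<nu> x *\<^sub>R weak_grad \<Omega> z x"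
  have zH: "z \<in> H10 \<Omega>" using z by (simp add: is_weak_solution_def)
  have "L2_inner \<Omega> ?\<tau> (classical_grad \<phi>) = - L2_inner \<Omega> \<phi> (\<lambda>x. (-1) *\<^sub>R g x)" if \<phi>: "\<phi> \<in> test_functions \<Omega>" for \<phi>
  proof -
    note P = H10_pair_H10[OF H10_pair_test_function[OF \<phi>]]
    have "L2_inner \<Omega> ?\<tau> (classical_grad \<phi>) = energy (weak_grad \<Omega> z) (weak_grad \<Omega> \<phi>)"
      unfolding energy_def[symmetric] using P by (intro energy_cong_AE weak_grad zH test_L2 \<phi>) auto
    also have "\<dots> = L2_inner \<Omega> g \<phi>" using z P by (simp add: is_weak_solution_iff)
    finally show ?thesis
      using L2_inner_commute[of \<Omega> g \<phi>] unfolding L2_inner_scaleR_right by simp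
  qed
  then have div: "has_weak_div \<Omega> ?\<tau> (\<lambda>x. (-1) *\<^sub>R g x)"
    using L2_scaleR[OF g] unfolding has_weak_div_iff by blast
  then show H: "?\<tau> \<in> Hdiv \<Omega>"
    using nu_L2[OF weak_grad(2)[OF zH]] by (auto simp: Hdiv_def)
  from has_weak_div_unique[OF weak_div(1)[OF H] div]
  show "AE x in lebesgue_on \<Omega>. g x + weak_div \<Omega> ?\<tau> x = 0"
    by eventually_elim simp
qed

end

section \<open>The optimal control problem\<close>

text \<open>At every point the value is one of \<open>u\<^sub>a\<close>, \<open>u\<^sub>b\<close>
  and the unprojected control, so its square is at most the sum of their three squares.\<close>

lemma v_proj_L2:
  assumes "\<zeta> \<in> L2 \<Omega>" "u\<^sub>d \<in> L2 \<Omega>" "u\<^sub>a \<in> L2 \<Omega>" "u\<^sub>b \<in> L2 \<Omega>"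
  shows "v_proj lam u\<^sub>d u\<^sub>a u\<^sub>b \<zeta> \<in> L2 \<Omega>"
proof (rule L2_bound)
  let ?s = "\<lambda>x. u\<^sub>d x - 1/lam * \<zeta> x"
  have s: "?s \<in> L2 \<Omega>" by (intro L2_diff L2_cmult assms)
  show "v_proj lam u\<^sub>d u\<^sub>a u\<^sub>b \<zeta> \<in> borel_measurable (lebesgue_on \<Omega>)"
    unfolding v_proj_def[abs_def] by (intro borel_measurable_min borel_measurable_max L2_measurable s assms)
  show "integrable (lebesgue_on \<Omega>) (\<lambda>x. (norm (u\<^sub>a x))\<^sup>2 + (norm (u\<^sub>b x))\<^sup>2 + (norm (?s x))\<^sup>2)"
    by (intro Bochner_Integration.integrable_add L2_integrable_norm_sq s assms)
  show "(norm (v_proj lam u\<^sub>d u\<^sub>a u\<^sub>b \<zeta> x))\<^sup>2 \<le> (norm (u\<^sub>a x))\<^sup>2 + (norm (u\<^sub>b x))\<^sup>2 + (norm (?s x))\<^sup>2" for x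
    by (auto simp: v_proj_def min_def max_def)
qed

lemma v_proj_U_ad:
  assumes "\<zeta> \<in> L2 \<Omega>" "u\<^sub>d \<in> L2 \<Omega>" "u\<^sub>a \<in> L2 \<Omega>" "u\<^sub>b \<in> L2 \<Omega>"
    and "AE x in lebesgue_on \<Omega>. u\<^sub>a x \<le> u\<^sub>b x"
  shows "v_proj lam u\<^sub>d u\<^sub>a u\<^sub>b \<zeta> \<in> U_ad \<Omega> u\<^sub>a u\<^sub>b"
proof -
  have "AE x in lebesgue_on \<Omega>. u\<^sub>a x \<le> v_proj lam u\<^sub>d u\<^sub>a u\<^sub>b \<zeta> x \<and> v_proj lam u\<^sub>d u\<^sub>a u\<^sub>b \<zeta> x \<le> u\<^sub>b x"
    using assms(5) by eventually_elim (auto simp: v_proj_def)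
  then show ?thesis using v_proj_L2[OF assms(1-4)] by (simp add: U_ad_def)
qed

text \<open>A projection onto an interval satisfies the obtuse angle inequality (s - w) * (u - w)
  \<le> 0 with s = \<open>u\<^sub>d x - 1/lam * p x\<close>. Multiplied by \<open>lam\<close> and
  expanded, it leaves the quadratic term that later forces u = w.\<close>

lemma v_proj_variational_inequality:
  fixes lam :: real and u\<^sub>d p :: "'a \<Rightarrow> real"
  assumes lam: "lam > 0" and u: "u\<^sub>a x \<le> u x" "u x \<le> u\<^sub>b x"
  defines "w \<equiv> v_proj lam u\<^sub>d u\<^sub>a u\<^sub>b p x"
  shows "(p x + lam * (u x - u\<^sub>d x)) * (w - u x) \<le> - lam * (w - u x)\<^sup>2"
proof -
  have "(u\<^sub>d x - 1/lam * p x - w) * (u x - w) \<le> 0"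
    using u by (auto simp: w_def v_proj_def min_def max_def mult_le_0_iff)
  then have "lam * ((u\<^sub>d x - 1/lam * p x - w) * (u x - w)) \<le> 0"
    using lam by (simp add: mult_le_0_iff)
  moreover have "lam * ((u\<^sub>d x - 1/lam * p x - w) * (u x - w)) =
      (p x + lam * (u x - u\<^sub>d x)) * (w - u x) + lam * (w - u x)\<^sup>2"
    using lam by (simp add: field_simps power2_eq_square)
  ultimately show ?thesis by simp
qed

lemma right_derivative_nonneg:
  fixes a b :: real
  assumes "\<And>t. 0 < t \<Longrightarrow> t \<le> 1 \<Longrightarrow> 0 \<le> t * a + t\<^sup>2 * b"
  shows "0 \<le> a"
proof (rule ccontr)
  assume a: "\<not> 0 \<le> a"
  \<comment> \<open>The quotient makes \<open>t * \<bar>b\<bar>\<close> smaller than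
    \<open>- a\<close>; the added 1 avoids division by zero and the minimum keeps \<open>t\<close>
    in the range of the hypothesis.\<close>
  define t where "t = min 1 (- a / (2 * (\<bar>b\<bar> + 1)))"
  have t: "0 < t" "t \<le> 1" using a by (auto simp: t_def divide_neg_pos)
  have "t * (\<bar>b\<bar> + 1) \<le> - a / (2 * (\<bar>b\<bar> + 1)) * (\<bar>b\<bar> + 1)"
    by (intro mult_right_mono) (auto simp: t_def)
  also have "\<dots> = - a / 2" by (simp add: field_simps)
  finally have "t * \<bar>b\<bar> < - a" using a t by (simp add: algebra_simps)
  moreover have "t * b \<le> t * \<bar>b\<bar>" using t by (intro mult_left_mono) auto
  ultimately have "a + t * b < 0" by linarith
  then have "t * (a + t * b) < 0" using t by (simp add: mult_pos_neg)
  then show False using assms[OF t] by (simp add: algebra_simps power2_eq_square)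
qed

section \<open>First-order optimality and the projection formula\<close>

context elliptic_problem
begin

lemma state_solves:
  "f \<in> L2 \<Omega> \<Longrightarrow> v \<in> L2 \<Omega> \<Longrightarrow> is_weak_solution \<Omega> \<nu> (\<lambda>x. f x + v x) (state \<Omega> \<nu> f v)"
  unfolding state_def by (intro weak_solution L2_add)

lemma adjoint_state_solves:
  assumes "f \<in> L2 \<Omega>" "v \<in> L2 \<Omega>" "y\<^sub>d \<in> L2 \<Omega>"
  shows "is_weak_solution \<Omega> \<nu> (\<lambda>x. state \<Omega> \<nu> f v x - y\<^sub>d x) (adjoint_state \<Omega> \<nu> f y\<^sub>d v)"
proof -
  have "state \<Omega> \<nu> f v \<in> L2 \<Omega>"
    using state_solves[OF assms(1,2)] weak_grad(3) by (auto simp: is_weak_solution_def)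
  then show ?thesis
    unfolding adjoint_state_def by (intro weak_solution L2_diff assms)
qed

text \<open>On the segment from \<open>u\<close> to \<open>w\<close> the state is affine in the step
  length \<open>t\<close>, hence the cost is a quadratic polynomial in \<open>t\<close> that is
  minimal at 0. Its slope there is nonnegative, and the adjoint equation rewrites the slope without
  the state increment.\<close>

lemma optimality_condition:
  assumes f: "f \<in> L2 \<Omega>" and y\<^sub>d: "y\<^sub>d \<in> L2 \<Omega>" and u\<^sub>d: "u\<^sub>d \<in> L2 \<Omega>"
    and opt: "optimal_control \<Omega> \<nu> lam f y\<^sub>d u\<^sub>d u\<^sub>a u\<^sub>b u" and w: "w \<in> U_ad \<Omega> u\<^sub>a u\<^sub>b"
  shows "0 \<le> L2_inner \<Omega> (\<lambda>x. adjoint_state \<Omega> \<nu> f y\<^sub>d u x + lam * (u x - u\<^sub>d x)) (\<lambda>x. w x - u x)"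
proof -
  let ?y = "state \<Omega> \<nu> f u" and ?p = "adjoint_state \<Omega> \<nu> f y\<^sub>d u"
  let ?d = "\<lambda>x. w x - u x" and ?X = "\<lambda>x. state \<Omega> \<nu> f u x - y\<^sub>d x" and ?U = "\<lambda>x. u x - u\<^sub>d x"
  have u: "u \<in> U_ad \<Omega> u\<^sub>a u\<^sub>b"
    and min: "\<And>v. v \<in> U_ad \<Omega> u\<^sub>a u\<^sub>b \<Longrightarrow>
      cost \<Omega> lam y\<^sub>d u\<^sub>d ?y u \<le> cost \<Omega> lam y\<^sub>d u\<^sub>d (state \<Omega> \<nu> f v) v"
    using opt by (auto simp: optimal_control_def is_arg_min_def not_less)
  have uL2: "u \<in> L2 \<Omega>" and wL2: "w \<in> L2 \<Omega>" using u w by (auto simp: U_ad_def)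
  have dL2: "?d \<in> L2 \<Omega>" and UL2: "?U \<in> L2 \<Omega>" and fuL2: "(\<lambda>x. f x + u x) \<in> L2 \<Omega>"
    by (intro L2_diff L2_add uL2 wL2 u\<^sub>d f)+
  note y_sol = state_solves[OF f uL2]
  define z where "z = weak_solution \<Omega> \<nu> ?d"
  have z_sol: "is_weak_solution \<Omega> \<nu> ?d z" unfolding z_def by (rule weak_solution[OF dL2])
  have H: "?y \<in> H10 \<Omega>" "z \<in> H10 \<Omega>" "?p \<in> H10 \<Omega>"
    using y_sol z_sol adjoint_state_solves[OF f uL2 y\<^sub>d] by (auto simp: is_weak_solution_def)
  note yL2 = weak_grad(3)[OF H(1)] and zL2 = weak_grad(3)[OF H(2)] and pL2 = weak_grad(3)[OF H(3)]
  have XL2: "?X \<in> L2 \<Omega>" by (intro L2_diff yL2 y\<^sub>d)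
  have "0 \<le> t * (L2_inner \<Omega> ?X z + lam * L2_inner \<Omega> ?U ?d)
      + t\<^sup>2 * (((L2_norm \<Omega> z)\<^sup>2 + lam * (L2_norm \<Omega> ?d)\<^sup>2) / 2)" if t: "0 < t" "t \<le> 1" for t
  proof -
    let ?v = "\<lambda>x. u x + t * ?d x"
    have vL2: "?v \<in> L2 \<Omega>" by (intro L2_add L2_cmult uL2 dL2)
    have "AE x in lebesgue_on \<Omega>. u\<^sub>a x \<le> ?v x \<and> ?v x \<le> u\<^sub>b x"
    proof -
      have "AE x in lebesgue_on \<Omega>. u\<^sub>a x \<le> u x \<and> u x \<le> u\<^sub>b x" "AE x in lebesgue_on \<Omega>. u\<^sub>a x \<le> w x \<and> w x \<le> u\<^sub>b x"
        using u w by (auto simp: U_ad_def)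
      then show ?thesis
      proof eventually_elim
        case (elim x)
        have "?v x = (1 - t) * u x + t * w x" by (simp add: algebra_simps)
        then show ?case
          using elim t convex_bound_le[of "u x" "u\<^sub>b x" "w x" "1 - t" t]
            convex_bound_le[of "- u x" "- u\<^sub>a x" "- w x" "1 - t" t] by auto
      qed
    qed
    then have v: "?v \<in> U_ad \<Omega> u\<^sub>a u\<^sub>b" using vL2 by (simp add: U_ad_def)
    have "is_weak_solution \<Omega> \<nu> (\<lambda>x. f x + ?v x) (\<lambda>x. ?y x + t * z x)"
      using is_weak_solution_lincomb[OF y_sol z_sol fuL2 dL2, of t] by (simp add: add.assoc)
    \<comment> \<open>\<open>state\<close> is a chosen solution, so it depends on the control
      affinely only up to null sets.\<close>
    then have eq: "AE x in lebesgue_on \<Omega>. state \<Omega> \<nu> f ?v x = ?y x + t * z x"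
      by (rule is_weak_solution_unique[OF state_solves[OF f vL2]]) (rule L2_add[OF f vL2])
    have "state \<Omega> \<nu> f ?v \<in> L2 \<Omega>"
      using state_solves[OF f vL2] weak_grad(3) by (auto simp: is_weak_solution_def)
    then have "L2_norm \<Omega> (\<lambda>x. state \<Omega> \<nu> f ?v x - y\<^sub>d x) = L2_norm \<Omega> (\<lambda>x. ?X x + t * z x)"
      using eq by (intro L2_norm_cong_AE L2_diff L2_add L2_cmult y\<^sub>d zL2 yL2) auto
    moreover have "L2_norm \<Omega> (\<lambda>x. ?v x - u\<^sub>d x) = L2_norm \<Omega> (\<lambda>x. ?U x + t * ?d x)"
      by (rule arg_cong[where f="L2_norm \<Omega>"]) auto
    ultimately have "cost \<Omega> lam y\<^sub>d u\<^sub>d (state \<Omega> \<nu> f ?v) ?v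
        = 1/2 * (L2_norm \<Omega> (\<lambda>x. ?X x + t * z x))\<^sup>2 + lam/2 * (L2_norm \<Omega> (\<lambda>x. ?U x + t * ?d x))\<^sup>2"
      by (simp only: cost_def)
    also have "\<dots> = cost \<Omega> lam y\<^sub>d u\<^sub>d ?y u + (t * (L2_inner \<Omega> ?X z + lam * L2_inner \<Omega> ?U ?d)
      + t\<^sup>2 * (((L2_norm \<Omega> z)\<^sup>2 + lam * (L2_norm \<Omega> ?d)\<^sup>2) / 2))"
      unfolding L2_norm_sq_perturb[OF XL2 zL2] L2_norm_sq_perturb[OF UL2 dL2] cost_def by argo
    finally show ?thesis using min[OF v] by simp
  qed
  then have "0 \<le> L2_inner \<Omega> ?X z + lam * L2_inner \<Omega> ?U ?d" by (rule right_derivative_nonneg)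
  \<comment> \<open>By symmetry of the energy form: the adjoint equation is tested with
    \<open>z\<close> and the equation of \<open>z\<close> with the adjoint state.\<close>
  moreover have "L2_inner \<Omega> ?X z = L2_inner \<Omega> ?p ?d"
  proof -
    have "L2_inner \<Omega> ?X z = energy (weak_grad \<Omega> ?p) (weak_grad \<Omega> z)"
      using adjoint_state_solves[OF f uL2 y\<^sub>d] H(2) by (simp add: is_weak_solution_iff)
    also have "\<dots> = energy (weak_grad \<Omega> z) (weak_grad \<Omega> ?p)" by (rule energy_commute)
    also have "\<dots> = L2_inner \<Omega> ?d ?p" using z_sol H(3) by (simp add: is_weak_solution_iff)
    finally show ?thesis by (simp only: L2_inner_commute)
  qed
  moreover have "L2_inner \<Omega> (\<lambda>x. ?p x + lam *\<^sub>R ?U x) ?d = L2_inner \<Omega> ?p ?d + lam * L2_inner \<Omega> ?U ?d"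
    by (simp only: L2_inner_add_left[OF pL2 L2_scaleR[OF UL2] dL2] L2_inner_scaleR_left)
  ultimately show ?thesis by simp
qed

text \<open>At the projection the optimality condition gives a nonnegative integral, whereas the
  pointwise inequality bounds it by \<open>- lam\<close> times the squared distance to
  \<open>u\<close>. That distance must vanish.\<close>

lemma v_proj_adjoint_eq_optimal_control:
  assumes f: "f \<in> L2 \<Omega>" and y\<^sub>d: "y\<^sub>d \<in> L2 \<Omega>" and u\<^sub>d: "u\<^sub>d \<in> L2 \<Omega>"
    and ab: "u\<^sub>a \<in> L2 \<Omega>" "u\<^sub>b \<in> L2 \<Omega>" "AE x in lebesgue_on \<Omega>. u\<^sub>a x \<le> u\<^sub>b x" and lam: "lam > 0"
    and opt: "optimal_control \<Omega> \<nu> lam f y\<^sub>d u\<^sub>d u\<^sub>a u\<^sub>b u"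
  shows "AE x in lebesgue_on \<Omega>. v_proj lam u\<^sub>d u\<^sub>a u\<^sub>b (adjoint_state \<Omega> \<nu> f y\<^sub>d u) x = u x"
proof -
  let ?p = "adjoint_state \<Omega> \<nu> f y\<^sub>d u"
  let ?w = "v_proj lam u\<^sub>d u\<^sub>a u\<^sub>b ?p"
  let ?d = "\<lambda>x. ?w x - u x" and ?q = "\<lambda>x. ?p x + lam * (u x - u\<^sub>d x)"
  have u: "u \<in> L2 \<Omega>" "AE x in lebesgue_on \<Omega>. u\<^sub>a x \<le> u x \<and> u x \<le> u\<^sub>b x"
    using opt by (auto simp: optimal_control_def is_arg_min_def U_ad_def)
  have pL2: "?p \<in> L2 \<Omega>"
    using adjoint_state_solves[OF f u(1) y\<^sub>d] weak_grad(3) by (auto simp: is_weak_solution_def)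
  have dL2: "?d \<in> L2 \<Omega>" and qL2: "?q \<in> L2 \<Omega>"
    by (intro L2_diff L2_add L2_cmult v_proj_L2 pL2 u ab u\<^sub>d)+
  have "0 \<le> L2_inner \<Omega> ?q ?d"
    by (rule optimality_condition[OF f y\<^sub>d u\<^sub>d opt v_proj_U_ad[OF pL2 u\<^sub>d ab]])
  also have "\<dots> \<le> (LINT x|lebesgue_on \<Omega>. - lam * (norm (?d x))\<^sup>2)"
    unfolding L2_inner_def
  proof (rule integral_mono_AE)
    show "AE x in lebesgue_on \<Omega>. ?q x \<bullet> ?d x \<le> - lam * (norm (?d x))\<^sup>2"
      using u(2)
    proof eventually_elim
      case (elim x)
      then show ?case
        using v_proj_variational_inequality[OF lam, of u\<^sub>a x u u\<^sub>b ?p u\<^sub>d] by simp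
    qed
  qed (intro L2_integrable_inner integrable_mult_right L2_integrable_norm_sq dL2 qL2)+
  also have "\<dots> = - lam * (L2_norm \<Omega> ?d)\<^sup>2" by (simp add: L2_norm_def)
  finally have "L2_norm \<Omega> ?d = 0" using lam by (simp add: mult_le_0_iff)
  from L2_norm_eq_0D[OF dL2 this] show ?thesis by eventually_elim simp
qed

section \<open>Nonnegativity of the majorant\<close>

lemma dual_energy_bound:
  assumes \<zeta>: "\<zeta> \<in> H10 \<Omega>" and \<rho>: "\<rho> \<in> Hdiv \<Omega>" and h: "h \<in> L2 \<Omega>"
  shows "nu_lo * L2_norm \<Omega> (weak_grad \<Omega> \<zeta>) \<le> L2_norm \<Omega> (\<lambda>x. \<rho> x - \<nu> x *\<^sub>R weak_grad \<Omega> \<zeta> x)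
    + C\<^sub>F * L2_norm \<Omega> (\<lambda>x. h x + weak_div \<Omega> \<rho> x) + C\<^sub>F * L2_norm \<Omega> h"
proof -
  let ?g = "weak_grad \<Omega> \<zeta>"
  let ?E = "\<lambda>x. \<rho> x - \<nu> x *\<^sub>R ?g x" and ?D = "\<lambda>x. h x + weak_div \<Omega> \<rho> x"
  note \<zeta>' = weak_grad[OF \<zeta>] and \<rho>' = weak_div[OF \<rho>]
  have \<rho>L2: "\<rho> \<in> L2 \<Omega>" using \<rho> by (simp add: Hdiv_def)
  have EL2: "?E \<in> L2 \<Omega>" and DL2: "?D \<in> L2 \<Omega>"
    by (intro L2_diff L2_add nu_L2 \<zeta>' \<rho>' \<rho>L2 h)+
  have "L2_inner \<Omega> ?E ?g = L2_inner \<Omega> \<rho> ?g - energy ?g ?g"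
    unfolding energy_def by (rule L2_inner_diff_left[OF \<rho>L2 nu_L2[OF \<zeta>'(2)] \<zeta>'(2)])
  moreover have "L2_inner \<Omega> ?D \<zeta> = L2_inner \<Omega> h \<zeta> + L2_inner \<Omega> (weak_div \<Omega> \<rho>) \<zeta>"
    by (rule L2_inner_add_left[OF h \<rho>'(2) \<zeta>'(3)])
  \<comment> \<open>Green's formula lets the flux \<rho> and its divergence cancel, so this holds
    for every \<rho>. Each term on the right is then bounded by a multiple of the gradient norm,
    which is divided out.\<close>
  ultimately have "energy ?g ?g = - L2_inner \<Omega> ?E ?g - L2_inner \<Omega> ?D \<zeta> + L2_inner \<Omega> h \<zeta>"
    using Green_formula[OF \<zeta> \<rho>] by simp
  also have "\<dots> \<le> L2_norm \<Omega> ?E * L2_norm \<Omega> ?g + L2_norm \<Omega> ?D * L2_norm \<Omega> \<zeta> + L2_norm \<Omega> h * L2_norm \<Omega> \<zeta>"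
    using L2_Cauchy_Schwarz[OF EL2 \<zeta>'(2)] L2_Cauchy_Schwarz[OF DL2 \<zeta>'(3)] L2_Cauchy_Schwarz[OF h \<zeta>'(3)] by linarith
  also have "\<dots> \<le> L2_norm \<Omega> ?E * L2_norm \<Omega> ?g + L2_norm \<Omega> ?D * (C\<^sub>F * L2_norm \<Omega> ?g) + L2_norm \<Omega> h * (C\<^sub>F * L2_norm \<Omega> ?g)"
    by (intro add_mono mult_left_mono Friedrichs \<zeta> L2_norm_nonneg order.refl)
  finally have "(nu_lo * L2_norm \<Omega> ?g) * L2_norm \<Omega> ?g
      \<le> (L2_norm \<Omega> ?E + C\<^sub>F * L2_norm \<Omega> ?D + C\<^sub>F * L2_norm \<Omega> h) * L2_norm \<Omega> ?g"
    using energy_coercive[OF \<zeta>'(2)] by (simp add: algebra_simps power2_eq_square)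
  then show ?thesis
    using L2_norm_nonneg[of \<Omega> ?g] C\<^sub>F_pos
    by (cases "L2_norm \<Omega> ?g = 0") (auto simp: L2_norm_nonneg mult_le_cancel_right)
qed

lemma residual_functional_bound:
  assumes \<zeta>: "\<zeta> \<in> H10 \<Omega>" and r: "r \<in> L2 \<Omega>" and q: "q \<in> L2 \<Omega>"
  shows "L2_inner \<Omega> r \<zeta> + L2_inner \<Omega> q (weak_grad \<Omega> \<zeta>)
    \<le> (L2_norm \<Omega> q + C\<^sub>F * L2_norm \<Omega> r) * L2_norm \<Omega> (weak_grad \<Omega> \<zeta>)"
proof -
  have "L2_inner \<Omega> r \<zeta> + L2_inner \<Omega> q (weak_grad \<Omega> \<zeta>)
      \<le> L2_norm \<Omega> r * L2_norm \<Omega> \<zeta> + L2_norm \<Omega> q * L2_norm \<Omega> (weak_grad \<Omega> \<zeta>)"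
    using L2_Cauchy_Schwarz[OF r weak_grad(3)[OF \<zeta>]] L2_Cauchy_Schwarz[OF q weak_grad(2)[OF \<zeta>]] by linarith
  also have "\<dots> \<le> L2_norm \<Omega> r * (C\<^sub>F * L2_norm \<Omega> (weak_grad \<Omega> \<zeta>)) + L2_norm \<Omega> q * L2_norm \<Omega> (weak_grad \<Omega> \<zeta>)"
    by (intro add_mono mult_left_mono Friedrichs \<zeta> L2_norm_nonneg order.refl)
  finally show ?thesis by (simp add: algebra_simps)
qed

end

text \<open>\<open>N\<close>, \<open>A\<close>, \<open>B\<close>, \<open>D\<close>, \<open>E\<close> are the norms in the majorant, \<open>z\<close> is the norm of the gradient of \<open>\<zeta>\<close>.\<close>

lemma majorant_terms_nonneg:
  fixes \<alpha> \<beta> N A B D E z C n l :: real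
  assumes pos: "0 < \<alpha>" "0 < \<beta>" "0 < C" "0 < n" "0 < l"
    and nonneg: "0 \<le> N" "0 \<le> A" "0 \<le> B" "0 \<le> D" "0 \<le> E"
    and z: "n * z \<le> E + C * D + C * N"
  shows "(A + C * B) * z \<le> \<alpha>/2 * N\<^sup>2 + (1 + \<alpha>) * (1 + \<beta>) * C^2 / (2 * \<alpha> * n^2) * A\<^sup>2
    + (1 + \<alpha>) * (1 + \<beta>) * C^4 / (2 * \<alpha> * \<beta> * n^2) * B\<^sup>2
    + 1/n * (C * D + E) * (C^3 / (l * n) * D + C^2 / (l * n) * E + C * B + A)
    + 3 * l / (2 * C^2) * (A + C * B)\<^sup>2"
proof -
  define S where "S = A + C * B"
  \<comment> \<open>Chosen so that the hypothesis on \<open>z\<close> becomes S * z \<le> (C * D +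
    E) * S / n + N * K, which separates the adjoint residuals from the tracking error
    \<open>N\<close>.\<close>
  define K where "K = C * S / n"
  have S: "0 \<le> S" and K: "0 \<le> K" using pos nonneg by (auto simp: S_def K_def)
  have "S\<^sup>2 \<le> (1 + \<beta>) * A\<^sup>2 + (1 + \<beta>) / \<beta> * (C * B)\<^sup>2"
  proof -
    \<comment> \<open>Young's inequality with weight \<beta>, written with its exact square
      remainder.\<close>
    have "(1 + \<beta>) * A\<^sup>2 + (1 + \<beta>) / \<beta> * (C * B)\<^sup>2 - S\<^sup>2 = (\<beta> * A - C * B)\<^sup>2 / \<beta>"
      using pos by (simp add: S_def field_simps power2_eq_square)
    moreover have "0 \<le> (\<beta> * A - C * B)\<^sup>2 / \<beta>" using pos by simp
    ultimately show ?thesis by linarith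
  qed
  then have "(1 + \<alpha>) * C\<^sup>2 / (2 * \<alpha> * n\<^sup>2) * S\<^sup>2
      \<le> (1 + \<alpha>) * C\<^sup>2 / (2 * \<alpha> * n\<^sup>2) * ((1 + \<beta>) * A\<^sup>2 + (1 + \<beta>) / \<beta> * (C * B)\<^sup>2)"
    using pos by (intro mult_left_mono) auto
  also have "\<dots> = (1 + \<alpha>) * (1 + \<beta>) * C^2 / (2 * \<alpha> * n^2) * A\<^sup>2
      + (1 + \<alpha>) * (1 + \<beta>) * C^4 / (2 * \<alpha> * \<beta> * n^2) * B\<^sup>2"
    using pos by (simp add: field_simps power2_eq_square power4_eq_xxxx)
  finally have AB: "(1 + \<alpha>) * C\<^sup>2 / (2 * \<alpha> * n\<^sup>2) * S\<^sup>2 \<le> \<dots>" .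
  have "N * K \<le> \<alpha>/2 * N\<^sup>2 + (1 + \<alpha>) * C\<^sup>2 / (2 * \<alpha> * n\<^sup>2) * S\<^sup>2"
  proof -
    \<comment> \<open>The coefficient of K^2 is (1 + \<alpha>) / (2 * \<alpha>) = 1 / (2 * \<alpha>)
      + 1/2: the first part completes the square with weight \<alpha>, the second is the surplus K^2
      / 2.\<close>
    have "\<alpha>/2 * N\<^sup>2 + (1 + \<alpha>) * C\<^sup>2 / (2 * \<alpha> * n\<^sup>2) * S\<^sup>2 - N * K = (\<alpha> * N - K)\<^sup>2 / (2 * \<alpha>) + K\<^sup>2 / 2"
      using pos by (simp add: K_def field_simps power2_eq_square)
    moreover have "0 \<le> (\<alpha> * N - K)\<^sup>2 / (2 * \<alpha>) + K\<^sup>2 / 2" using pos by simp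
    ultimately show ?thesis by linarith
  qed
  \<comment> \<open>The second factor of the product term is \<open>S\<close> plus nonnegative
    multiples of \<open>D\<close> and \<open>E\<close>.\<close>
  moreover have "1/n * (C * D + E) * S \<le> 1/n * (C * D + E) * (C^3 / (l * n) * D + C^2 / (l * n) * E + C * B + A)"
    using pos nonneg by (intro mult_left_mono) (auto simp: S_def)
  moreover have "S * z \<le> 1/n * (C * D + E) * S + N * K"
  proof -
    have "z \<le> (E + C * D + C * N) / n" using z pos by (simp add: field_simps)
    then have "S * z \<le> S * ((E + C * D + C * N) / n)" using S by (rule mult_left_mono)
    also have "\<dots> = 1/n * (C * D + E) * S + N * K" using pos by (simp add: K_def field_simps)
    finally show ?thesis .
  qed
  moreover have "0 \<le> 3 * l / (2 * C^2) * (A + C * B)\<^sup>2" using pos by simp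
  ultimately show ?thesis using AB unfolding S_def[symmetric] by linarith
qed

text \<open>In \<open>ereal\<close> the infimum is the greatest lower bound with no side condition
  on boundedness, so a lower bound and arbitrarily small values together determine it.\<close>

lemma INF_ereal_eq_0:
  assumes "\<And>x. x \<in> S \<Longrightarrow> 0 \<le> F x" "\<And>e::real. e > 0 \<Longrightarrow> \<exists>x\<in>S. F x \<le> ereal e"
  shows "(INF x\<in>S. F x) = 0"
proof (rule antisym)
  show "(INF x\<in>S. F x) \<le> 0"
  proof (rule ereal_le_epsilon2)
    fix e :: real assume "0 < e"
    then obtain x where "x \<in> S" "F x \<le> ereal e" using assms(2) by blast
    then show "(INF x\<in>S. F x) \<le> 0 + ereal e" by (simp add: INF_lower2)
  qed
qed (use assms(1) in \<open>simp add: INF_greatest\<close>)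

context elliptic_problem
begin

lemma majorant_nonneg:
  assumes f: "f \<in> L2 \<Omega>" and y\<^sub>d: "y\<^sub>d \<in> L2 \<Omega>" and v: "v \<in> L2 \<Omega>" and lam: "lam > 0" and \<alpha>\<beta>: "\<alpha> > 0" "\<beta> > 0"
    and \<eta>: "\<eta> \<in> H10 \<Omega>" and \<zeta>: "\<zeta> \<in> H10 \<Omega>" and \<tau>: "\<tau> \<in> Hdiv \<Omega>" and \<rho>: "\<rho> \<in> Hdiv \<Omega>"
  shows "0 \<le> majorant \<Omega> \<nu> nu_lo C\<^sub>F lam f y\<^sub>d \<alpha> \<beta> \<eta> \<zeta> \<tau> \<rho> v"
proof -
  let ?r = "\<lambda>x. f x + v x + weak_div \<Omega> \<tau> x" and ?q = "\<lambda>x. \<tau> x - \<nu> x *\<^sub>R weak_grad \<Omega> \<eta> x"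
  have r: "?r \<in> L2 \<Omega>" by (intro L2_add f v weak_div \<tau>)
  have q: "?q \<in> L2 \<Omega>" using \<tau> by (intro L2_diff nu_L2 weak_grad \<eta>) (simp add: Hdiv_def)
  have h: "(\<lambda>x. \<eta> x - y\<^sub>d x) \<in> L2 \<Omega>" by (intro L2_diff weak_grad \<eta> y\<^sub>d)
  have "L2_inner \<Omega> ?r \<zeta> + L2_inner \<Omega> ?q (weak_grad \<Omega> \<zeta>)
      \<le> (L2_norm \<Omega> ?q + C\<^sub>F * L2_norm \<Omega> ?r) * L2_norm \<Omega> (weak_grad \<Omega> \<zeta>)"
    by (rule residual_functional_bound[OF \<zeta> r q])
  also note majorant_terms_nonneg[OF \<alpha>\<beta> C\<^sub>F_pos nu_lo_pos lam L2_norm_nonneg L2_norm_nonneg L2_norm_nonneg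
      L2_norm_nonneg L2_norm_nonneg dual_energy_bound[OF \<zeta> \<rho> h]]
  \<comment> \<open>The chain bounds the two sign-indefinite integrals by the sum of the other
    terms; the majorant is exactly the difference.\<close>
  finally show ?thesis
    unfolding majorant_def Let_def L2_inner_def inner_real_def by linarith
qed

text \<open>Allowing any \<open>v\<close> that agrees with \<open>u\<close> almost everywhere covers
  both uses: \<open>u\<close> itself and the projection of the adjoint state. The flux residuals are
  zero identically, the equilibrium residuals almost everywhere.\<close>

lemma majorant_vanishing_residuals:
  assumes "is_weak_solution \<Omega> \<nu> (\<lambda>x. f x + u x) \<eta>" "(\<lambda>x. f x + u x) \<in> L2 \<Omega>"
    and "is_weak_solution \<Omega> \<nu> (\<lambda>x. \<eta> x - y\<^sub>d x) \<zeta>" "(\<lambda>x. \<eta> x - y\<^sub>d x) \<in> L2 \<Omega>"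
    and "AE x in lebesgue_on \<Omega>. v x = u x"
  shows "majorant \<Omega> \<nu> nu_lo C\<^sub>F lam f y\<^sub>d \<alpha> \<beta> \<eta> \<zeta> (\<lambda>x. \<nu> x *\<^sub>R weak_grad \<Omega> \<eta> x)
    (\<lambda>x. \<nu> x *\<^sub>R weak_grad \<Omega> \<zeta> x) v = \<alpha> / 2 * (L2_norm \<Omega> (\<lambda>x. \<eta> x - y\<^sub>d x))\<^sup>2"
proof -
  let ?\<tau> = "\<lambda>x. \<nu> x *\<^sub>R weak_grad \<Omega> \<eta> x" and ?\<rho> = "\<lambda>x. \<nu> x *\<^sub>R weak_grad \<Omega> \<zeta> x"
  have B: "AE x in lebesgue_on \<Omega>. f x + v x + weak_div \<Omega> ?\<tau> x = 0"
    using flux_of_weak_solution(2)[OF assms(1,2)] assms(5) by eventually_elim simp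
  have B0: "L2_norm \<Omega> (\<lambda>x. f x + v x + weak_div \<Omega> ?\<tau> x) = 0"
    by (rule L2_norm_eq_0_AE[OF B])
  have D0: "L2_norm \<Omega> (\<lambda>x. \<eta> x - y\<^sub>d x + weak_div \<Omega> ?\<rho> x) = 0"
    by (rule L2_norm_eq_0_AE[OF flux_of_weak_solution(2)[OF assms(3,4)]])
  have "(LINT x|lebesgue_on \<Omega>. (f x + v x + weak_div \<Omega> ?\<tau> x) * \<zeta> x) = 0"
    using B by (intro integral_eq_zero_AE) auto
  moreover have "L2_norm \<Omega> (\<lambda>x. 0 :: 'a) = 0" by (simp add: L2_norm_eq_0_AE)
  ultimately show ?thesis by (simp add: majorant_def B0 D0)
qed

end

lemma small_multiple:
  fixes c e :: real
  assumes "0 < e" "0 \<le> c"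
  shows "\<exists>\<alpha>>0. \<alpha> / 2 * c \<le> e"
proof (intro exI conjI)
  \<comment> \<open>With this \<alpha> the product is e * c / (c + 1); the added 1 covers
    \<open>c = 0\<close>.\<close>
  show "0 < 2 * e / (c + 1)" using assms by simp
  show "2 * e / (c + 1) / 2 * c \<le> e" using assms by (simp add: field_simps)
qed

theorem proposition2:
  fixes \<Omega> :: "(real ^ 'd) set"
    and \<nu> f y\<^sub>d u\<^sub>d u\<^sub>a u\<^sub>b u :: "real ^ 'd \<Rightarrow> real"
    and nu_lo nu_hi lam C\<^sub>F :: real
  assumes "CARD('d) \<in> {1, 2, 3}"
    and "bounded_Lipschitz_domain \<Omega>"
    and "y\<^sub>d \<in> L2 \<Omega>" "u\<^sub>d \<in> L2 \<Omega>" "f \<in> L2 \<Omega>" "u\<^sub>a \<in> L2 \<Omega>" "u\<^sub>b \<in> L2 \<Omega>"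
    and "lam > 0"
    and "\<nu> \<in> borel_measurable (lebesgue_on \<Omega>)"
    and "0 < nu_lo" "\<And>x. x \<in> \<Omega> \<Longrightarrow> nu_lo \<le> \<nu> x \<and> \<nu> x \<le> nu_hi"
    and "C\<^sub>F > 0" "\<And>w. w \<in> H10 \<Omega> \<Longrightarrow> L2_norm \<Omega> w \<le> C\<^sub>F * L2_norm \<Omega> (weak_grad \<Omega> w)"
    and "AE x in lebesgue_on \<Omega>. u\<^sub>a x \<le> u\<^sub>b x"
    and "optimal_control \<Omega> \<nu> lam f y\<^sub>d u\<^sub>d u\<^sub>a u\<^sub>b u"
  shows "let M = majorant \<Omega> \<nu> nu_lo C\<^sub>F lam f y\<^sub>d;
             v = v_proj lam u\<^sub>d u\<^sub>a u\<^sub>b;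
             y = state \<Omega> \<nu> f u;
             p = adjoint_state \<Omega> \<nu> f y\<^sub>d u;
             \<tau>\<^sub>0 = (\<lambda>x. \<nu> x *\<^sub>R weak_grad \<Omega> y x);
             \<rho>\<^sub>0 = (\<lambda>x. \<nu> x *\<^sub>R weak_grad \<Omega> p x)
         in (INF (\<eta>, \<zeta>, \<tau>, \<rho>, \<alpha>, \<beta>) \<in> H10 \<Omega> \<times> H10 \<Omega> \<times> Hdiv \<Omega> \<times> Hdiv \<Omega> \<times> {0<..} \<times> {0<..}.
               ereal (M \<alpha> \<beta> \<eta> \<zeta> \<tau> \<rho> (v \<zeta>))) = 0 \<and>
            y \<in> H10 \<Omega> \<and> p \<in> H10 \<Omega> \<and> \<tau>\<^sub>0 \<in> Hdiv \<Omega> \<and> \<rho>\<^sub>0 \<in> Hdiv \<Omega> \<and>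
            (AE x in lebesgue_on \<Omega>. v p x = u x) \<and>
            (INF (\<alpha>, \<beta>) \<in> {0<..} \<times> {0<..}. ereal (M \<alpha> \<beta> y p \<tau>\<^sub>0 \<rho>\<^sub>0 u)) = 0"
proof -
  interpret elliptic_problem \<Omega> \<nu> nu_lo nu_hi C\<^sub>F
    using assms(2,9-13) by unfold_locales (auto simp: bounded_Lipschitz_domain_def)
  note f = \<open>f \<in> L2 \<Omega>\<close> and y\<^sub>d = \<open>y\<^sub>d \<in> L2 \<Omega>\<close>
  let ?M = "majorant \<Omega> \<nu> nu_lo C\<^sub>F lam f y\<^sub>d" and ?v = "v_proj lam u\<^sub>d u\<^sub>a u\<^sub>b"
  let ?y = "state \<Omega> \<nu> f u" and ?p = "adjoint_state \<Omega> \<nu> f y\<^sub>d u"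
  let ?\<tau> = "\<lambda>x. \<nu> x *\<^sub>R weak_grad \<Omega> ?y x" and ?\<rho> = "\<lambda>x. \<nu> x *\<^sub>R weak_grad \<Omega> ?p x"
  let ?N = "(L2_norm \<Omega> (\<lambda>x. ?y x - y\<^sub>d x))\<^sup>2"
  have u: "u \<in> L2 \<Omega>"
    using assms(15) by (auto simp: optimal_control_def is_arg_min_def U_ad_def)
  note y_sol = state_solves[OF f u] and p_sol = adjoint_state_solves[OF f u y\<^sub>d]
  have H: "?y \<in> H10 \<Omega>" "?p \<in> H10 \<Omega>"
    using y_sol p_sol by (auto simp: is_weak_solution_def)
  have fu: "(\<lambda>x. f x + u x) \<in> L2 \<Omega>" and yd: "(\<lambda>x. ?y x - y\<^sub>d x) \<in> L2 \<Omega>"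
    by (intro L2_add L2_diff f u y\<^sub>d weak_grad H)+
  have Hdiv: "?\<tau> \<in> Hdiv \<Omega>" "?\<rho> \<in> Hdiv \<Omega>"
    by (rule flux_of_weak_solution(1)[OF y_sol fu] flux_of_weak_solution(1)[OF p_sol yd])+
  have vp: "AE x in lebesgue_on \<Omega>. ?v ?p x = u x"
    by (rule v_proj_adjoint_eq_optimal_control[OF f y\<^sub>d]) fact+
  have exact: "?M \<alpha> \<beta> ?y ?p ?\<tau> ?\<rho> v = \<alpha> / 2 * ?N" if "AE x in lebesgue_on \<Omega>. v x = u x" for \<alpha> \<beta> v
    by (rule majorant_vanishing_residuals[OF y_sol fu p_sol yd that])
  have exact_u: "?M \<alpha> \<beta> ?y ?p ?\<tau> ?\<rho> u = \<alpha> / 2 * ?N" for \<alpha> \<beta>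
    by (rule exact) simp
  have small: "\<exists>\<alpha>>0. \<alpha> / 2 * ?N \<le> e" if "0 < e" for e :: real
    using small_multiple[OF that, of ?N] by simp
  have "(INF (\<eta>, \<zeta>, \<tau>, \<rho>, \<alpha>, \<beta>) \<in> H10 \<Omega> \<times> H10 \<Omega> \<times> Hdiv \<Omega> \<times> Hdiv \<Omega> \<times> {0<..} \<times> {0<..}.
      ereal (?M \<alpha> \<beta> \<eta> \<zeta> \<tau> \<rho> (?v \<zeta>))) = 0"
  proof (rule INF_ereal_eq_0, goal_cases)
    case (1 x)
    then show ?case
      using majorant_nonneg[OF f y\<^sub>d v_proj_L2[OF weak_grad(3) assms(4,6,7)] assms(8)]
      by (auto simp del: split_paired_All)
  next
    case (2 e)
    then obtain \<alpha> where "\<alpha> > 0" "\<alpha> / 2 * ?N \<le> e" using small by blast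
    then show ?case
      \<comment> \<open>Every term that contains \<beta> has a vanishing residual as a factor, so
        the value 1 is as good as any; only \<alpha> has to be small.\<close>
      using H Hdiv exact[OF vp, of \<alpha> 1]
      by (intro bexI[of _ "(?y, ?p, ?\<tau>, ?\<rho>, \<alpha>, 1)"]) auto
  qed
  moreover have "(INF (\<alpha>, \<beta>) \<in> {0<..} \<times> {0<..}. ereal (?M \<alpha> \<beta> ?y ?p ?\<tau> ?\<rho> u)) = 0"
  proof (rule INF_ereal_eq_0, goal_cases)
    case (1 x)
    then show ?case by (auto simp: exact_u)
  next
    case (2 e)
    then obtain \<alpha> where "\<alpha> > 0" "\<alpha> / 2 * ?N \<le> e" using small by blast
    then show ?case
      using exact_u[of \<alpha> 1] by (intro bexI[of _ "(\<alpha>, 1)"]) auto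
  qed
  ultimately show ?thesis using H Hdiv vp by (simp add: Let_def)
qed

end
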